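(* Let $\mathbb K$ be a field with $\mathrm{char}(\mathbb K)\neq2$ and let $q\in\mathbb K$ be nonzero and not a root of $1$. Let $x,y,z$ be the equitable generators of $U_q(\mathfrak{sl}_2)$ and let $\Omega=\exp_q(n_z)\,\Psi\,\exp_q(n_y)$. Then on each finite dimensional $U_q(\mathfrak{sl}_2)$-module $$\Omega^{-1}x\,\Omega=y,\qquad \Omega^{-1}y\,\Omega=z,\qquad \Omega^{-1}z\,\Omega=x.$$
   Context: $U_q(\mathfrak{sl}_2)$ denotes the unital associative $\mathbb K$-algebra with generators $k^{\pm1},e,f$ and relations $kk^{-1}=k^{-1}k=1$, $ke=q^2ek$, $kf=q^{-2}fk$, $ef-fe=\frac{k-k^{-1}}{q-q^{-1}}$. Its equitable generators are $x^{\pm1}=k^{\pm1}$, $y=k^{-1}+f(q-q^{-1})$, $z=k^{-1}-k^{-1}e\,q(q-q^{-1})$; they satisfy $\frac{qxy-q^{-1}yx}{q-q^{-1}}=\frac{qyz-q^{-1}zy}{q-q^{-1}}=\frac{qzx-q^{-1}xz}{q-q^{-1}}=1$. Define in $U_q(\mathfrak{sl}_2)$: $n_y=\frac{q(1-zx)}{q-q^{-1}}=\frac{q^{-1}(1-xz)}{q-q^{-1}}$ and $n_z=\frac{q(1-xy)}{q-q^{-1}}=\frac{q^{-1}(1-yx)}{q-q^{-1}}$. They act nilpotently on every finite dimensional module. Write $[n]=\frac{q^n-q^{-n}}{q-q^{-1}}$ and $[n]^!=[n][n-1]\cdots[1]$, $[0]^!=1$. For an operator $T$ acting nilpotently on finite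 dimensional modules, $\exp_q(T)=\sum_{i=0}^\infty\frac{q^{i(i-1)/2}}{[i]^!}T^i$; it is invertible on each such module. For a finite dimensional module $M$, $\varepsilon\in\{1,-1\}$ and $\lambda\in\mathbb Z$, the weight space is $M(\varepsilon,\lambda)=\{v\in M: xv=\varepsilon q^\lambda v\}$; $M$ is the direct sum of its weight spaces. $\Psi$ is the linear operator acting on each finite dimensional module $M$ so that on $M(\varepsilon,\lambda)$ it is $q^{-\lambda^2/2}$ times the identity if $\lambda$ is even and $q^{(1-\lambda^2)/2}$ times the identity if $\lambda$ is odd; it is invertible. $\Omega$ is thus an invertible linear operator on each finite dimensional module. *)

theory Defs
  imports
    "HOL-Algebra.QuotRing"
    "HOL-Algebra.Algebraic_Closure_Type"
    "HOL-Library.Poly_Mapping"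
begin

section \<open>The algebra \<open>U\<^sub>q(sl\<^sub>2)\<close> by generators and relations\<close>

datatype uq_gen = Gen_k | Gen_kinv | Gen_e | Gen_f

text \<open>The free monoid on the four generators, written additively because
  multiplication of \<^typ>\<open>'a \<Rightarrow>\<^sub>0 'b\<close> is convolution along \<open>+\<close>. Hence
  \<open>uq_word \<Rightarrow>\<^sub>0 'k\<close> with its ring structure is the free unital associative \<open>'k\<close>-algebra.\<close>

datatype uq_word = Word "uq_gen list"

instantiation uq_word :: monoid_add
begin

definition zero_uq_word :: uq_word where
  "0 = Word []"

fun plus_uq_word :: "uq_word \<Rightarrow> uq_word \<Rightarrow> uq_word" where
  "Word u + Word v = Word (u @ v)"

instance
proof
  fix a b c :: uq_word
  show "a + b + c = a + (b + c)" by (cases a; cases b; cases c) simp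
  show "0 + a = a" by (cases a) (simp add: zero_uq_word_def)
  show "a + 0 = a" by (cases a) (simp add: zero_uq_word_def)
qed

end

type_synonym 'k uq_free = "uq_word \<Rightarrow>\<^sub>0 'k"

definition free_gen :: "uq_gen \<Rightarrow> 'k::field uq_free" where
  "free_gen g = Poly_Mapping.single (Word [g]) 1"

definition free_const :: "'k::field \<Rightarrow> 'k uq_free" where
  "free_const c = Poly_Mapping.single 0 c"

definition uq_relations :: "'k::field \<Rightarrow> 'k uq_free set" where
  "uq_relations q =
    (let k = free_gen Gen_k; k' = free_gen Gen_kinv; e = free_gen Gen_e; f = free_gen Gen_f
     in {k * k' - 1,
         k' * k - 1,
         k * e - free_const (q ^ 2) * e * k,
         k * f - free_const (inverse q ^ 2) * f * k,
         e * f - f * e - free_const (1 / (q - inverse q)) * (k - k')})"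

definition uq_ideal :: "'k::field \<Rightarrow> 'k uq_free set" where
  "uq_ideal q = Idl\<^bsub>ring_of_type_algebra\<^esub> (uq_relations q)"

definition Uq :: "'k::field \<Rightarrow> 'k uq_free set ring" where
  "Uq q = ring_of_type_algebra Quot (uq_ideal q)"

definition uq_class :: "'k::field \<Rightarrow> 'k uq_free \<Rightarrow> 'k uq_free set" where
  "uq_class q a = uq_ideal q +>\<^bsub>ring_of_type_algebra\<^esub> a"

definition uq_scale :: "'k::field \<Rightarrow> 'k \<Rightarrow> 'k uq_free set \<Rightarrow> 'k uq_free set" where
  "uq_scale q c a = uq_class q (free_const c) \<otimes>\<^bsub>Uq q\<^esub> a"

definition uq_k :: "'k::field \<Rightarrow> 'k uq_free set" where
  "uq_k q = uq_class q (free_gen Gen_k)"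

definition uq_kinv :: "'k::field \<Rightarrow> 'k uq_free set" where
  "uq_kinv q = uq_class q (free_gen Gen_kinv)"

definition uq_e :: "'k::field \<Rightarrow> 'k uq_free set" where
  "uq_e q = uq_class q (free_gen Gen_e)"

definition uq_f :: "'k::field \<Rightarrow> 'k uq_free set" where
  "uq_f q = uq_class q (free_gen Gen_f)"

section \<open>Equitable generators and the elements \<open>n\<^sub>y\<close>, \<open>n\<^sub>z\<close>\<close>

definition uq_x :: "'k::field \<Rightarrow> 'k uq_free set" where
  "uq_x q = uq_k q"

definition uq_y :: "'k::field \<Rightarrow> 'k uq_free set" where
  "uq_y q = uq_kinv q \<oplus>\<^bsub>Uq q\<^esub> uq_scale q (q - inverse q) (uq_f q)"

definition uq_z :: "'k::field \<Rightarrow> 'k uq_free set" where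
  "uq_z q = uq_kinv q \<ominus>\<^bsub>Uq q\<^esub> uq_scale q (q * (q - inverse q)) (uq_kinv q \<otimes>\<^bsub>Uq q\<^esub> uq_e q)"

definition uq_ny :: "'k::field \<Rightarrow> 'k uq_free set" where
  "uq_ny q = uq_scale q (q / (q - inverse q))
     (\<one>\<^bsub>Uq q\<^esub> \<ominus>\<^bsub>Uq q\<^esub> (uq_z q \<otimes>\<^bsub>Uq q\<^esub> uq_x q))"

definition uq_nz :: "'k::field \<Rightarrow> 'k uq_free set" where
  "uq_nz q = uq_scale q (q / (q - inverse q))
     (\<one>\<^bsub>Uq q\<^esub> \<ominus>\<^bsub>Uq q\<^esub> (uq_x q \<otimes>\<^bsub>Uq q\<^esub> uq_y q))"

section \<open>Modules\<close>

text \<open>Left unital modules over the \<open>'k\<close>-algebra \<^term>\<open>Uq q\<close>; the underlying vector space is the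
  whole type \<open>'v\<close>, and \<open>act\<close> is only constrained on the carrier of \<^term>\<open>Uq q\<close>.\<close>

locale uq_module = vector_space scale
  for q :: "'k::field"
    and scale :: "'k \<Rightarrow> 'v::ab_group_add \<Rightarrow> 'v"
    and act :: "'k uq_free set \<Rightarrow> 'v \<Rightarrow> 'v" +
  assumes act_linear: "a \<in> carrier (Uq q) \<Longrightarrow> Vector_Spaces.linear scale scale (act a)"
    and act_one: "act \<one>\<^bsub>Uq q\<^esub> v = v"
    and act_mult: "\<lbrakk>a \<in> carrier (Uq q); b \<in> carrier (Uq q)\<rbrakk>
          \<Longrightarrow> act (a \<otimes>\<^bsub>Uq q\<^esub> b) v = act a (act b v)"
    and act_add: "\<lbrakk>a \<in> carrier (Uq q); b \<in> carrier (Uq q)\<rbrakk>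
          \<Longrightarrow> act (a \<oplus>\<^bsub>Uq q\<^esub> b) v = act a v + act b v"
    and act_scale: "a \<in> carrier (Uq q) \<Longrightarrow> act (uq_scale q c a) v = scale c (act a v)"

section \<open>The operators \<open>exp\<^sub>q\<close>, \<open>\<Psi>\<close> and \<open>\<Omega>\<close>\<close>

definition q_int :: "'k::field \<Rightarrow> nat \<Rightarrow> 'k" where
  "q_int q n = (q ^ n - inverse q ^ n) / (q - inverse q)"

definition q_fact :: "'k::field \<Rightarrow> nat \<Rightarrow> 'k" where
  "q_fact q n = (\<Prod>j=1..n. q_int q j)"

text \<open>The sum over all natural numbers is \<^const>\<open>Sum_any\<close>, the sum over the finitely many nonzero
  terms; it is meaningful for (locally) nilpotent \<open>T\<close>.\<close>

definition q_exp ::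
  "'k::field \<Rightarrow> ('k \<Rightarrow> 'v::ab_group_add \<Rightarrow> 'v) \<Rightarrow> ('v \<Rightarrow> 'v) \<Rightarrow> 'v \<Rightarrow> 'v" where
  "q_exp q scale T v = (\<Sum>i. scale (q ^ (i * (i - 1) div 2) / q_fact q i) ((T ^^ i) v))"

definition weight_space ::
  "'k::field \<Rightarrow> ('k \<Rightarrow> 'v::ab_group_add \<Rightarrow> 'v) \<Rightarrow> ('k uq_free set \<Rightarrow> 'v \<Rightarrow> 'v) \<Rightarrow> 'k \<Rightarrow> int \<Rightarrow> 'v set"
  where
  "weight_space q scale act \<epsilon> m = {v. act (uq_x q) v = scale (\<epsilon> * q powi m) v}"

text \<open>Both integer divisions below are exact.\<close>

definition Psi_coeff :: "'k::field \<Rightarrow> int \<Rightarrow> 'k" where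
  "Psi_coeff q m = (if even m then q powi (- (m\<^sup>2 div 2)) else q powi ((1 - m\<^sup>2) div 2))"

text \<open>\<open>\<Psi>\<close> is unique because the module is the direct sum of its weight spaces.\<close>

definition uq_Psi ::
  "'k::field \<Rightarrow> ('k \<Rightarrow> 'v::ab_group_add \<Rightarrow> 'v) \<Rightarrow> ('k uq_free set \<Rightarrow> 'v \<Rightarrow> 'v) \<Rightarrow> 'v \<Rightarrow> 'v" where
  "uq_Psi q scale act =
    (THE P. Vector_Spaces.linear scale scale P \<and>
       (\<forall>\<epsilon>\<in>{1, -1}. \<forall>m. \<forall>v\<in>weight_space q scale act \<epsilon> m. P v = scale (Psi_coeff q m) v))"

definition uq_Omega ::
  "'k::field \<Rightarrow> ('k \<Rightarrow> 'v::ab_group_add \<Rightarrow> 'v) \<Rightarrow> ('k uq_free set \<Rightarrow> 'v \<Rightarrow> 'v) \<Rightarrow> 'v \<Rightarrow> 'v" where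
  "uq_Omega q scale act =
    q_exp q scale (act (uq_nz q)) \<circ> uq_Psi q scale act \<circ> q_exp q scale (act (uq_ny q))"

end

theory Submission
  imports Defs "HOL-Computational_Algebra.Polynomial"
begin

text \<open>
  On a module the elements \<open>n\<^sub>y\<close> and \<open>n\<^sub>z\<close> act as \<open>e\<close> and \<open>- q k f\<close>, while \<open>x = k\<close>, \<open>y = k\<inverse> + \<delta> f\<close> and
  \<open>z = k\<inverse> - q \<delta> k\<inverse> e\<close> with \<open>\<delta> = q - q\<inverse>\<close>. The theorem thus asserts three intertwining relations
  \<open>x \<Omega> = \<Omega> y\<close>, \<open>y \<Omega> = \<Omega> z\<close>, \<open>z \<Omega> = \<Omega> x\<close>, together with the invertibility of \<open>\<Omega>\<close>, and each relation is
  obtained by moving one operator through the three factors of \<open>\<Omega>\<close> in turn.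

  Both pairs \<open>(T, A) = (e, k)\<close> and \<open>(T, A) = (n\<^sub>z, k\<inverse>)\<close> satisfy \<open>A T = q\<^sup>2 T A\<close>. This relation alone forces \<open>T\<close>
  to be nilpotent (\<open>nilpotent_if_scaled_by_conjugation\<close>) and gives \<open>A exp\<^sub>q(T) = exp\<^sub>q(q\<^sup>2 T) A\<close>. With the
  functional equation \<open>exp\<^sub>q(T) = exp\<^sub>q(q\<^sup>2 T) (1 - (q\<^sup>2 - 1) T)\<close> it shows how \<open>A\<close> and its inverse pass through
  \<open>exp\<^sub>q(T)\<close> (\<open>exp_A\<close>, \<open>exp_A'\<close>); any \<open>g\<close> with \<open>T g - g T = A - A\<inverse>\<close> passes through as well
  (\<open>exp_commutator\<close>). The last rule applies to \<open>g = \<delta> f\<close> in the first pair and to \<open>g = - q \<delta> k\<inverse> e\<close> in the second.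

  \<open>\<Psi>\<close> is a function of \<open>k\<close>, so it commutes with \<open>k\<close>, and its eigenvalues are chosen such that
  \<open>\<Psi> e = k\<inverse> e k\<inverse> \<Psi>\<close> and \<open>\<Psi> f = k f k \<Psi>\<close>. That \<open>\<Psi>\<close> is well defined requires that the weight
  vectors span the module. The proof of this uses the Casimir element. The operators \<open>f\<^sup>n e\<^sup>n\<close> and \<open>e\<^sup>n f\<^sup>n\<close> are,
  up to scalars, products of factors \<open>D m = casimir - q\<^bsup>2m+1\<^esup> k - q\<^bsup>-2m-1\<^esup> k\<inverse>\<close>, over \<open>0 \<le> m < n\<close> and over
  \<open>-n \<le> m < 0\<close> respectively. Both products vanish for large \<open>n\<close>. A common zero of the two products, regarded as
  polynomials in the commuting variables \<open>casimir\<close> and \<open>k\<^bsup>\<plusminus>1\<^esup>\<close>, lies on exactly one curve of each family, and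
  these two curves meet transversally there, because \<open>q\<close> is not a root of unity and \<open>2 \<noteq> 0\<close>. Hence
  \<open>casimir\<close> and \<open>k\<close> are simultaneously diagonalizable, with eigenvalues \<open>\<plusminus>q\<^sup>m\<close> for \<open>k\<close>
  (\<open>weight_decomposition\<close>).
\<close>

section \<open>Operators on a finite-dimensional space\<close>

text \<open>A locale of its own, so that the abbreviation \<open>endom\<close> below is not inherited by the global
  interpretation of \<^locale>\<open>vector_space\<close> for real vector spaces, which would capture the name.\<close>
locale fd_space = finite_dimensional_vector_space scale Basis
  for scale :: "'a::field \<Rightarrow> 'b::ab_group_add \<Rightarrow> 'b" (infixr \<open>*s\<close> 75)
    and Basis :: "'b set"
begin

abbreviation endom :: "('b \<Rightarrow> 'b) \<Rightarrow> bool" where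
  "endom T \<equiv> Vector_Spaces.linear (*s) (*s) T"

lemma endom_iff:
  "endom T \<longleftrightarrow> (\<forall>v w. T (v + w) = T v + T w) \<and> (\<forall>c v. T (c *s v) = c *s T v)"
  unfolding Vector_Spaces.linear_iff using vector_space_axioms by blast

lemma endom_apply:
  assumes "endom T"
  shows "T (v + w) = T v + T w" "T (v - w) = T v - T w" "T (- v) = - T v"
    "T 0 = 0" "T (c *s v) = c *s T v" "T (sum g I) = (\<Sum>i\<in>I. T (g i))"
proof -
  interpret T: Vector_Spaces.linear "(*s)" "(*s)" T by fact
  show "T (v + w) = T v + T w" "T (v - w) = T v - T w" "T (- v) = - T v"
    "T 0 = 0" "T (c *s v) = c *s T v" "T (sum g I) = (\<Sum>i\<in>I. T (g i))"
    by (rule T.add T.diff T.neg T.zero T.scale T.sum)+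
qed

lemma endom_funpow: "endom T \<Longrightarrow> endom (T ^^ n)"
  by (induction n) (auto simp: endom_iff)

lemma endom_sum: "(\<And>i. i \<in> I \<Longrightarrow> endom (F i)) \<Longrightarrow> endom (\<lambda>v. \<Sum>i\<in>I. c i *s F i v)"
  by (auto simp: endom_iff sum.distrib scale_right_distrib scale_sum_right mult.commute)

lemma endom_eq_on_span:
  assumes "endom R" "endom T" "\<And>v. v \<in> W \<Longrightarrow> R v = T v" "span W = UNIV"
  shows "R v = T v"
proof -
  have "v \<in> span W" using assms(4) by simp
  then show ?thesis
    by (induction rule: span_induct_alt) (simp_all add: assms(3) endom_apply[OF assms(1)] endom_apply[OF assms(2)])
qed

text \<open>A preimage of an eigenvector is a multiple of it, and preimages add up. Used to remove, from a vector with known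
  image under \<open>T\<close>, the part that is already understood.\<close>
lemma eigen_span_surj:
  assumes T: "endom T" and eig: "\<And>x. x \<in> W \<Longrightarrow> \<exists>c. c \<noteq> 0 \<and> T x = c *s x" and w: "w \<in> span W"
  shows "\<exists>v\<in>span W. T v = w"
  using w
proof (induction rule: span_induct_alt)
  case base
  then show ?case using endom_apply(4)[OF T] span_zero by blast
next
  case (step a x y)
  obtain v where v: "v \<in> span W" "T v = y" using step by blast
  obtain c where c: "c \<noteq> 0" "T x = c *s x" using eig step by blast
  have "T ((a / c) *s x + v) = a *s x + y" using c v by (simp add: endom_apply[OF T])
  moreover have "(a / c) *s x + v \<in> span W" using v(1) span_base[OF step(1)] by (intro span_add span_scale)
  ultimately show ?case by blast
qed

lemma funpow_commute_scaled:
  assumes "endom A" "endom T" "\<And>v. A (T v) = c *s T (A v)"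
  shows "A ((T ^^ n) v) = c ^ n *s (T ^^ n) (A v)"
  by (induction n) (simp_all add: assms(3) endom_apply[OF assms(2)] endom_apply[OF assms(1)])

definition poly_op :: "'a poly \<Rightarrow> ('b \<Rightarrow> 'b) \<Rightarrow> 'b \<Rightarrow> 'b" where
  "poly_op p T v = (\<Sum>i\<le>degree p. coeff p i *s (T ^^ i) v)"

lemma endom_poly_op: "endom T \<Longrightarrow> endom (poly_op p T)"
  unfolding poly_op_def[abs_def] by (intro endom_sum endom_funpow)

lemma poly_op_eq_sum: "degree p \<le> n \<Longrightarrow> poly_op p T v = (\<Sum>i\<le>n. coeff p i *s (T ^^ i) v)"
  unfolding poly_op_def
  by (rule sum.mono_neutral_left) (auto simp: coeff_eq_0)

lemma poly_op_0: "poly_op 0 T v = 0"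
  by (simp add: poly_op_def)

lemma poly_op_add: "poly_op (p + r) T v = poly_op p T v + poly_op r T v"
  using degree_add_le_max[of p r]
  by (simp add: poly_op_eq_sum[of _ "max (degree p) (degree r)"] sum.distrib scale_left_distrib)

lemma poly_op_smult: "poly_op (smult c p) T v = c *s poly_op p T v"
  by (simp add: poly_op_eq_sum[of _ "degree p"] scale_sum_right)

lemma poly_op_pCons:
  assumes "endom T"
  shows "poly_op (pCons a p) T v = a *s v + T (poly_op p T v)"
proof -
  have "poly_op (pCons a p) T v = (\<Sum>i\<le>Suc (degree p). coeff (pCons a p) i *s (T ^^ i) v)"
    by (rule poly_op_eq_sum) (rule degree_pCons_le)
  also have "\<dots> = a *s v + (\<Sum>i\<le>degree p. coeff p i *s (T ^^ Suc i) v)"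
    by (subst sum.atMost_Suc_shift) simp
  finally show ?thesis
    by (simp add: poly_op_def endom_apply[OF assms])
qed

lemma poly_op_mult:
  assumes "endom T"
  shows "poly_op (p * r) T v = poly_op p T (poly_op r T v)"
  by (induction p)
     (simp_all add: poly_op_0 mult_pCons_left poly_op_add poly_op_smult poly_op_pCons[OF assms] del: smult_add_right)

lemma poly_op_eigen:
  assumes T: "endom T" and v: "T v = c *s v"
  shows "poly_op p T v = poly p c *s v"
proof -
  have "(T ^^ i) v = c ^ i *s v" for i
    by (induction i) (simp_all add: v endom_apply[OF T] mult.commute)
  then show ?thesis
    by (simp add: poly_op_def poly_altdef scale_sum_left)
qed

lemma exists_annihilating_poly_at:
  assumes T: "endom T"
  shows "\<exists>p. p \<noteq> 0 \<and> poly_op p T v = 0"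
proof (cases "inj_on (\<lambda>i. (T ^^ i) v) {..dim UNIV}")
  case False
  then obtain i j where ij: "i \<noteq> j" "(T ^^ i) v = (T ^^ j) v"
    by (auto simp: inj_on_def)
  have "poly_op (monom 1 i + smult (-1) (monom 1 j)) T v = 0"
    unfolding poly_op_add poly_op_smult using ij
    by (simp add: poly_op_eq_sum[OF degree_monom_le] if_distrib[where f="\<lambda>c. c *s _"] if_distrib[where f="coeff _"]
         cong: if_cong)
  moreover have "coeff (monom 1 i + smult (-1) (monom (1::'a) j)) i = 1"
    using ij by simp
  ultimately show ?thesis by (metis coeff_0 zero_neq_one)
next
  case True
  let ?S = "(\<lambda>i. (T ^^ i) v) ` {..dim UNIV}"
  have "card ?S = Suc (dim UNIV)" using card_image[OF True] by simp
  then have "dependent ?S"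
    using dim_subset_UNIV[of ?S] dim_UNIV
    by (intro dependent_biggerset_general) (simp add: dimension_def)
  then obtain u w where u: "w \<in> ?S" "u w \<noteq> 0" "(\<Sum>w\<in>?S. u w *s w) = 0"
    by (auto simp: dependent_finite)
  define p where "p = Abs_poly (\<lambda>i. if i \<le> dim UNIV then u ((T ^^ i) v) else 0)"
  have co: "coeff p i = (if i \<le> dim UNIV then u ((T ^^ i) v) else 0)" for i
    unfolding p_def by (subst coeff_Abs_poly[where n = "dim UNIV"]) auto
  have "degree p \<le> dim UNIV" by (rule degree_le) (simp add: co)
  then have "poly_op p T v = (\<Sum>i\<le>dim UNIV. u ((T ^^ i) v) *s (T ^^ i) v)"
    by (simp add: poly_op_eq_sum co)
  also have "\<dots> = 0" using u(3) by (simp only: sum.reindex[OF True] o_def)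
  finally have "poly_op p T v = 0" .
  moreover have "p \<noteq> 0"
  proof -
    obtain i where "i \<le> dim UNIV" "w = (T ^^ i) v" using u(1) by auto
    then have "coeff p i \<noteq> 0" using u(2) by (simp only: co if_True simp_thms not_False_eq_True)
    then show ?thesis by force
  qed
  ultimately show ?thesis by blast
qed

lemma exists_annihilating_poly:
  assumes T: "endom T"
  shows "\<exists>p. p \<noteq> 0 \<and> (\<forall>v. poly_op p T v = 0)"
proof -
  obtain P where P: "\<And>v. P v \<noteq> 0" "\<And>v. poly_op (P v) T v = 0"
    using exists_annihilating_poly_at[OF T] by metis
  define p where "p = prod P Basis"
  have "p \<noteq> 0" using P finite_Basis by (simp add: p_def)
  moreover have "poly_op p T v = 0" for v
  proof (rule endom_eq_on_span[OF endom_poly_op[OF T], where T = "\<lambda>_. 0"])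
    show "endom (\<lambda>_. 0)" by (simp add: endom_iff)
    fix b assume "b \<in> Basis"
    then have "p = prod P (Basis - {b}) * P b"
      by (simp add: p_def prod.remove[OF finite_Basis] mult.commute)
    then show "poly_op p T b = 0"
      by (simp add: poly_op_mult[OF T] P endom_apply[OF endom_poly_op[OF T]])
  qed (rule span_Basis)
  ultimately show ?thesis by blast
qed

text \<open>If \<open>p\<close> has minimal degree \<open>d\<close> among the nonzero polynomials with \<open>p(T) = 0\<close>, then conjugation by \<open>A\<close> yields
  \<open>p(c T) = 0\<close>. The combination \<open>c\<^sup>d p(t) - p(c t)\<close> also kills \<open>T\<close> and has smaller degree, so it is zero. As
  \<open>c\<close> is not a root of unity, only the leading coefficient of \<open>p\<close> survives, and \<open>T\<^sup>d = 0\<close>. Eigenvalues of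
  \<open>T\<close> in an extension field are thereby avoided.\<close>
lemma nilpotent_if_scaled_by_conjugation:
  assumes A: "endom A" and T: "endom T" and A': "\<And>v. A (A' v) = v"
    and comm: "\<And>v. A (T v) = c *s T (A v)"
    and c: "\<And>n. n > 0 \<Longrightarrow> c ^ n \<noteq> 1" "c \<noteq> 0"
  shows "\<exists>n. \<forall>v. (T ^^ n) v = 0"
proof -
  define Q where "Q p \<longleftrightarrow> p \<noteq> 0 \<and> (\<forall>v. poly_op p T v = 0)" for p
  obtain p where p: "Q p" "\<And>r. Q r \<Longrightarrow> degree p \<le> degree r"
    using exists_annihilating_poly[OF T] ex_has_least_nat[of Q _ degree] unfolding Q_def by blast
  define d where "d = degree p"
  define r where "r = smult (c ^ d) p - pcompose p [:0, c:]"
  have co: "coeff r i = (c ^ d - c ^ i) * coeff p i" for i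
    by (simp add: r_def coeff_pcompose_linear algebra_simps)
  have deg: "degree r \<le> d"
    by (rule degree_le) (simp add: co d_def coeff_eq_0)
  have "poly_op r T v = 0" for v
  proof -
    have "poly_op r T v = c ^ d *s poly_op p T v - A (poly_op p T (A' v))"
      using deg
      by (simp add: poly_op_eq_sum[of _ d] co d_def endom_apply[OF A] funpow_commute_scaled[OF A T comm] A'
           scale_sum_right scale_left_diff_distrib sum_subtractf algebra_simps)
    then show ?thesis using p(1) by (simp add: Q_def endom_apply[OF A])
  qed
  moreover have "degree r < degree p" if "r \<noteq> 0"
  proof -
    have "coeff r d = 0" by (simp add: co)
    then have "degree r \<noteq> d" using that leading_coeff_neq_0 by blast
    then show ?thesis using deg by (simp add: d_def)
  qed
  ultimately have "r = 0" using p(2)[of r] unfolding Q_def by force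
  have low: "coeff p i = 0" if "i < d" for i
  proof -
    have "c ^ d \<noteq> c ^ i"
    proof
      assume "c ^ d = c ^ i"
      then have "c ^ i * c ^ (d - i) = c ^ i * 1" using that by (simp flip: power_add)
      then show False using c that by simp
    qed
    then show ?thesis using co[of i] \<open>r = 0\<close> by simp
  qed
  have lc: "coeff p d \<noteq> 0" using p(1) by (simp add: Q_def d_def)
  have "(T ^^ d) v = 0" for v
  proof -
    have "poly_op p T v = coeff p d *s (T ^^ d) v"
      unfolding poly_op_def d_def[symmetric]
      by (subst sum.remove[of _ d]) (auto simp: low intro!: sum.neutral)
    then show ?thesis using p(1) lc by (simp add: Q_def)
  qed
  then show ?thesis by blast
qed

end

section \<open>The q-exponential\<close>

locale q_space = fd_space scale Basis
  for scale :: "'a::field \<Rightarrow> 'b::ab_group_add \<Rightarrow> 'b" (infixr \<open>*s\<close> 75)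
    and Basis :: "'b set" +
  fixes q :: 'a
  assumes q_nonzero: "q \<noteq> 0" and q_not_root: "\<And>n::nat. n > 0 \<Longrightarrow> q ^ n \<noteq> 1"
begin

lemma q_sq_power_not_1: "n > 0 \<Longrightarrow> (q\<^sup>2) ^ n \<noteq> 1"
  using q_not_root[of "2 * n"] by (simp add: power_mult)

lemma q_minus_inverse_nonzero: "q - inverse q \<noteq> 0"
  using q_not_root[of 2] q_nonzero by (auto simp: field_simps power2_eq_square)

lemma q_powi_eq_1_iff: "q powi m = 1 \<longleftrightarrow> m = 0"
proof
  assume "q powi m = 1"
  show "m = 0"
  proof (rule ccontr)
    assume "m \<noteq> 0"
    then have "nat \<bar>m\<bar> > 0" by simp
    moreover have "q ^ nat \<bar>m\<bar> = 1"
      using \<open>q powi m = 1\<close> by (auto simp: power_int_def abs_if nat_minus_as_int field_simps split: if_splits)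
    ultimately show False using q_not_root by blast
  qed
qed simp

lemma q_powi_inject: "q powi m = q powi n \<longleftrightarrow> m = n"
proof
  assume "q powi m = q powi n"
  then have "q powi (m - n) = 1" using q_nonzero by (simp add: power_int_diff)
  then show "m = n" by (simp add: q_powi_eq_1_iff)
qed simp

definition exp_coeff :: "nat \<Rightarrow> 'a" where
  "exp_coeff i = q ^ (i * (i - 1) div 2) / q_fact q i"

lemma exp_coeff_0: "exp_coeff 0 = 1"
  by (simp add: exp_coeff_def q_fact_def)

lemma q_int_nonzero: "n > 0 \<Longrightarrow> q_int q n \<noteq> 0"
proof -
  assume "n > 0"
  have "q ^ n \<noteq> inverse q ^ n"
  proof
    assume "q ^ n = inverse q ^ n"
    then have "q ^ n * q ^ n = 1" using q_nonzero by (simp add: field_simps)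
    then have "q ^ (2 * n) = 1" by (simp only: mult_2 power_add)
    then show False using q_not_root[of "2 * n"] \<open>n > 0\<close> by simp
  qed
  then show ?thesis using q_minus_inverse_nonzero by (simp add: q_int_def)
qed

lemma exp_coeff_Suc: "exp_coeff (Suc n) = exp_coeff n * q ^ n / q_int q (Suc n)"
proof -
  have "Suc n * (Suc n - 1) div 2 = n * (n - 1) div 2 + n"
  proof -
    have "Suc n * (Suc n - 1) = n * (n - 1) + 2 * n" by (cases n) (auto simp: algebra_simps)
    then show ?thesis by simp
  qed
  then show ?thesis by (simp add: exp_coeff_def q_fact_def power_add)
qed

lemma q_int_Suc_up: "(\<Sum>j\<le>n. (q\<^sup>2) ^ j) = q ^ n * q_int q (Suc n)"
proof -
  have "(\<Sum>j\<le>n. (q\<^sup>2) ^ j) = ((q\<^sup>2) ^ Suc n - 1) / (q\<^sup>2 - 1)"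
    using geometric_sum[of "q\<^sup>2" "Suc n"] q_sq_power_not_1[of 1] by (simp only: lessThan_Suc_atMost) simp
  also have "\<dots> = q ^ n * q_int q (Suc n)"
    using q_minus_inverse_nonzero q_nonzero q_sq_power_not_1[of 1]
    by (simp add: q_int_def field_simps power2_eq_square power_mult_distrib)
  finally show ?thesis .
qed

lemma q_int_Suc_down: "(\<Sum>j\<le>n. (inverse (q\<^sup>2)) ^ j) = q_int q (Suc n) / q ^ n"
proof -
  have "(\<Sum>j\<le>n. (inverse (q\<^sup>2)) ^ j) = (\<Sum>j\<le>n. inverse ((q\<^sup>2) ^ n) * (q\<^sup>2) ^ (n - j))"
    using q_nonzero by (intro sum.cong) (auto simp: field_simps simp flip: power_add)
  also have "\<dots> = inverse ((q\<^sup>2) ^ n) * (\<Sum>j\<le>n. (q\<^sup>2) ^ j)"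
    unfolding sum_distrib_left[symmetric]
    by (rule arg_cong[where f = "(*) _"], rule sum.reindex_bij_witness[of _ "\<lambda>j. n - j" "\<lambda>j. n - j"]) auto
  also have "\<dots> = q_int q (Suc n) / q ^ n"
    using q_nonzero by (simp only: q_int_Suc_up) (simp add: field_simps power2_eq_square power_mult_distrib)
  finally show ?thesis .
qed

lemma exp_coeff_Suc_sum_up: "exp_coeff (Suc n) * (\<Sum>j\<le>n. (q\<^sup>2) ^ j) = exp_coeff n * (q\<^sup>2) ^ n"
  using q_int_nonzero[of "Suc n"]
  by (simp only: exp_coeff_Suc q_int_Suc_up) (simp add: power2_eq_square power_mult_distrib)

lemma exp_coeff_Suc_sum_down: "exp_coeff (Suc n) * (\<Sum>j\<le>n. (inverse (q\<^sup>2)) ^ j) = exp_coeff n"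
  using q_int_nonzero[of "Suc n"] q_nonzero
  by (simp add: exp_coeff_Suc q_int_Suc_down)

text \<open>The coefficientwise form of \<open>exp\<^sub>q(q\<^sup>2 t) - exp\<^sub>q(t) = (q\<^sup>2 - 1) t exp\<^sub>q(q\<^sup>2 t)\<close>.\<close>
lemma exp_coeff_functional: "exp_coeff (Suc n) * ((q\<^sup>2) ^ Suc n - 1) = exp_coeff n * (q\<^sup>2) ^ n * (q\<^sup>2 - 1)"
proof -
  have "(q\<^sup>2) ^ Suc n - 1 = (q\<^sup>2 - 1) * (\<Sum>j\<le>n. (q\<^sup>2) ^ j)"
    by (simp only: power_diff_1_eq lessThan_Suc_atMost)
  then have "exp_coeff (Suc n) * ((q\<^sup>2) ^ Suc n - 1) = exp_coeff (Suc n) * (\<Sum>j\<le>n. (q\<^sup>2) ^ j) * (q\<^sup>2 - 1)"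
    by (simp only: mult_ac)
  then show ?thesis by (simp only: exp_coeff_Suc_sum_up)
qed

lemma q_exp_eq_sum:
  assumes T: "endom T" and nil: "\<And>v. (T ^^ n) v = 0"
  shows "q_exp q (*s) T v = (\<Sum>i<n. exp_coeff i *s (T ^^ i) v)"
  unfolding q_exp_def exp_coeff_def
proof (rule Sum_any.expand_superset)
  have "(T ^^ i) v = 0" if "i \<ge> n" for i
  proof -
    have "(T ^^ i) v = (T ^^ (i - n)) ((T ^^ n) v)"
      using that by (simp only: le_add_diff_inverse2 comp_apply[of "T ^^ (i - n)" "T ^^ n" v, symmetric] funpow_add[symmetric])
    then show ?thesis by (simp add: nil endom_apply[OF endom_funpow[OF T]])
  qed
  then show "{i. (q ^ (i * (i - 1) div 2) / q_fact q i) *s (T ^^ i) v \<noteq> 0} \<subseteq> {..<n}"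
    by (auto intro: ccontr)
qed simp

end

text \<open>The setting shared by the two exponentials in \<open>\<Omega>\<close>; nilpotency of \<open>T\<close> is a consequence of \<open>comm\<close>.\<close>
locale q_shift = q_space +
  fixes T A A' :: "'b \<Rightarrow> 'b"
  assumes endoms: "endom T" "endom A" "endom A'"
    and inv: "\<And>v. A (A' v) = v" "\<And>v. A' (A v) = v"
    and comm: "\<And>v. A (T v) = q\<^sup>2 *s T (A v)"
begin

lemmas T_apply = endom_apply[OF endoms(1)]
lemmas A_apply = endom_apply[OF endoms(2)]
lemmas A'_apply = endom_apply[OF endoms(3)]

lemma comm': "A' (T v) = inverse (q\<^sup>2) *s T (A' v)"
proof -
  have "T (A' v) = A' (A (T (A' v)))" by (simp only: inv)
  also have "\<dots> = q\<^sup>2 *s A' (T v)" by (simp only: comm A'_apply inv)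
  finally show ?thesis using q_nonzero by simp
qed

definition nil_index :: nat where "nil_index = (SOME n. \<forall>v. (T ^^ n) v = 0)"

lemma funpow_nil_index: "(T ^^ nil_index) v = 0"
proof -
  have q2: "q\<^sup>2 \<noteq> 0" using q_nonzero by simp
  have "\<exists>n. \<forall>v. (T ^^ n) v = 0"
    by (rule nilpotent_if_scaled_by_conjugation[where A = A and A' = A' and c = "q\<^sup>2"])
       (fact endoms inv comm q_sq_power_not_1 q2)+
  then have "\<forall>v. (T ^^ nil_index) v = 0" unfolding nil_index_def by (rule someI_ex[where P = "\<lambda>n. \<forall>v. (T ^^ n) v = 0"])
  then show ?thesis by (rule spec)
qed

definition exp_T :: "'b \<Rightarrow> 'b" where "exp_T = q_exp q (*s) T"
definition exp_q2T :: "'b \<Rightarrow> 'b" where "exp_q2T = q_exp q (*s) (\<lambda>v. q\<^sup>2 *s T v)"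

lemma endom_scaled: "endom (\<lambda>v. c *s T v)"
  by (simp add: endom_iff T_apply scale_right_distrib mult.commute)

lemma funpow_scaled: "((\<lambda>v. c *s T v) ^^ n) v = c ^ n *s (T ^^ n) v"
  by (induction n) (simp_all add: T_apply mult.commute)

lemma exp_T_sum: "exp_T v = (\<Sum>i<nil_index. exp_coeff i *s (T ^^ i) v)"
  unfolding exp_T_def by (rule q_exp_eq_sum[OF endoms(1) funpow_nil_index])

lemma exp_q2T_sum: "exp_q2T v = (\<Sum>i<nil_index. (exp_coeff i * (q\<^sup>2) ^ i) *s (T ^^ i) v)"
  unfolding exp_q2T_def by (subst q_exp_eq_sum[OF endom_scaled, of nil_index]) (simp_all add: funpow_scaled funpow_nil_index)

lemma endom_exp_T: "endom exp_T"
  unfolding exp_T_sum[abs_def] by (intro endom_sum endom_funpow endoms(1))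

lemma endom_exp_q2T: "endom exp_q2T"
  unfolding exp_q2T_sum[abs_def] by (intro endom_sum endom_funpow endoms(1))

text \<open>If \<open>T\<^sup>m v = 0\<close> with \<open>m\<close> minimal positive, then applying \<open>T\<^bsup>m-1\<^esup>\<close> to \<open>exp\<^sub>q(T) v\<close> leaves only
  the constant term, namely \<open>T\<^bsup>m-1\<^esup> v \<noteq> 0\<close>.\<close>
lemma inj_exp_T: "inj exp_T"
proof -
  interpret lin: Vector_Spaces.linear "(*s)" "(*s)" exp_T by (rule endom_exp_T)
  have "v = 0" if "exp_T v = 0" for v
  proof (rule ccontr)
    assume "v \<noteq> 0"
    define m where "m = (LEAST m. (T ^^ m) v = 0)"
    have m: "(T ^^ m) v = 0" unfolding m_def by (rule LeastI[of _ nil_index]) (rule funpow_nil_index)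
    have mn: "m \<le> nil_index" unfolding m_def by (rule Least_le) (rule funpow_nil_index)
    obtain k where k: "m = Suc k" using m \<open>v \<noteq> 0\<close> by (cases m) auto
    have k0: "(T ^^ k) v \<noteq> 0"
      using not_less_Least[of k "\<lambda>m. (T ^^ m) v = 0"] k by (auto simp: m_def)
    have van: "(T ^^ k) ((T ^^ i) v) = 0" if "i > 0" for i
    proof -
      have "(T ^^ k) ((T ^^ i) v) = (T ^^ (i - 1)) ((T ^^ m) v)"
      proof -
        have "k + i = i - 1 + m" using that k by simp
        then show ?thesis by (metis comp_apply funpow_add)
      qed
      then show ?thesis by (simp add: m endom_apply[OF endom_funpow[OF endoms(1)]])
    qed
    have "(T ^^ k) (exp_T v) = (\<Sum>i<nil_index. exp_coeff i *s (T ^^ k) ((T ^^ i) v))"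
      by (simp add: exp_T_sum endom_apply[OF endom_funpow[OF endoms(1)]])
    also have "\<dots> = (T ^^ k) v"
      using k mn by (subst sum.remove[of _ 0]) (auto simp: van exp_coeff_0 intro!: sum.neutral)
    finally show False using k0 that by (simp add: endom_apply[OF endom_funpow[OF endoms(1)]])
  qed
  then show ?thesis by (simp add: lin.inj_iff_eq_0)
qed

lemma T_exp_q2T: "T (exp_q2T v) = exp_q2T (T v)" 
proof -
  show ?thesis by (simp add: exp_q2T_sum T_apply flip: funpow_swap1)
qed

lemma functional_equation: "exp_T v = exp_q2T (v - (q\<^sup>2 - 1) *s T v)"
proof -
  have "exp_q2T ((q\<^sup>2 - 1) *s T v) = (\<Sum>i<nil_index. (exp_coeff (Suc i) * ((q\<^sup>2) ^ Suc i - 1)) *s (T ^^ Suc i) v)"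
    unfolding exp_q2T_sum exp_coeff_functional
    by (rule sum.cong) (simp_all add: endom_apply[OF endom_funpow[OF endoms(1)]] funpow_swap1 mult_ac)
  also have "\<dots> = (\<Sum>i<Suc nil_index. (exp_coeff i * ((q\<^sup>2) ^ i - 1)) *s (T ^^ i) v)"
    by (subst sum.lessThan_Suc_shift) simp
  also have "\<dots> = (\<Sum>i<nil_index. (exp_coeff i * ((q\<^sup>2) ^ i - 1)) *s (T ^^ i) v)"
    using funpow_nil_index by simp
  also have "\<dots> = exp_q2T v - exp_T v"
    by (simp add: exp_T_sum exp_q2T_sum algebra_simps sum_subtractf scale_left_diff_distrib)
  finally show ?thesis by (simp add: endom_apply[OF endom_exp_q2T])
qed

lemma A_exp: "A (exp_T v) = exp_q2T (A v)"
proof -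
  show ?thesis
    by (simp add: exp_T_sum exp_q2T_sum A_apply funpow_commute_scaled[OF endoms(2,1) comm])
qed

lemma exp_A: "exp_T (A v) = A (exp_T v) - (q\<^sup>2 - 1) *s T (A (exp_T v))"
  by (simp only: A_exp functional_equation[of "A v"] endom_apply[OF endom_exp_q2T] T_exp_q2T)

lemma exp_A': "exp_T (A' (v - (q\<^sup>2 - 1) *s T v)) = A' (exp_T v)"
proof -
  have "A (exp_T (A' (v - (q\<^sup>2 - 1) *s T v))) = exp_T v"
    by (simp add: A_exp inv functional_equation[of v])
  then show ?thesis by (metis inv(2))
qed

text \<open>Moving \<open>g\<close> through \<open>T\<^bsup>n+1\<^esup>\<close> produces \<open>T\<^sup>n A\<close> and \<open>T\<^sup>n A'\<close> with geometric sums in \<open>q\<^sup>2\<close> and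
  \<open>q\<^bsup>-2\<^esup>\<close> as coefficients. The coefficients of \<open>exp\<^sub>q\<close> are such that the first sum turns the
  series into \<open>exp\<^sub>q(q\<^sup>2 T) A = A exp\<^sub>q(T)\<close> and the second into \<open>exp\<^sub>q(T) A'\<close>.\<close>
lemma exp_commutator:
  assumes g: "endom g" and Tg: "\<And>v. T (g v) - g (T v) = A v - A' v"
  shows "exp_T (g v) = g (exp_T v) + A (exp_T v) - exp_T (A' v)"
proof -
  let ?u = "\<lambda>n. \<Sum>j\<le>n. (q\<^sup>2) ^ j" and ?d = "\<lambda>n. \<Sum>j\<le>n. (inverse (q\<^sup>2)) ^ j"
  have Tg': "T (g v) = g (T v) + A v - A' v" for v using Tg[of v] by (simp add: algebra_simps)
  have pow: "(T ^^ Suc n) (g v) = g ((T ^^ Suc n) v) + ?u n *s (T ^^ n) (A v) - ?d n *s (T ^^ n) (A' v)" for n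
  proof (induction n)
    case 0
    then show ?case by (simp add: Tg')
  next
    case (Suc n)
    have "(T ^^ Suc (Suc n)) (g v) = T ((T ^^ Suc n) (g v))" by simp
    also have "\<dots> = T (g ((T ^^ Suc n) v)) + ?u n *s (T ^^ Suc n) (A v) - ?d n *s (T ^^ Suc n) (A' v)"
      by (subst Suc) (simp add: T_apply)
    also have "T (g ((T ^^ Suc n) v)) = g ((T ^^ Suc (Suc n)) v) + (q\<^sup>2) ^ Suc n *s (T ^^ Suc n) (A v)
        - (inverse (q\<^sup>2)) ^ Suc n *s (T ^^ Suc n) (A' v)"
      by (simp only: Tg' funpow_commute_scaled[OF endoms(2,1) comm] funpow_commute_scaled[OF endoms(3,1) comm']) simp
    finally show ?case
      by (simp add: scale_left_distrib algebra_simps)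
  qed
  have Suc_n: "exp_T v = (\<Sum>i<Suc nil_index. exp_coeff i *s (T ^^ i) v)" for v
    by (simp add: exp_T_sum funpow_nil_index)
  have shift: "exp_T v = v + (\<Sum>i<nil_index. exp_coeff (Suc i) *s (T ^^ Suc i) v)" for v
    unfolding Suc_n by (subst sum.lessThan_Suc_shift) (simp add: exp_coeff_0)
  have "exp_T (g v) = g v + (\<Sum>i<nil_index. exp_coeff (Suc i) *s (g ((T ^^ Suc i) v) + ?u i *s (T ^^ i) (A v) - ?d i *s (T ^^ i) (A' v)))"
    unfolding shift pow ..
  also have "\<dots> = g v + (\<Sum>i<nil_index. exp_coeff (Suc i) *s g ((T ^^ Suc i) v))
      + (\<Sum>i<nil_index. (exp_coeff (Suc i) * ?u i) *s (T ^^ i) (A v)) - (\<Sum>i<nil_index. (exp_coeff (Suc i) * ?d i) *s (T ^^ i) (A' v))"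
    by (simp add: scale_right_distrib scale_right_diff_distrib sum.distrib sum_subtractf del: funpow.simps)
  also have "\<dots> = g (exp_T v) + exp_q2T (A v) - exp_T (A' v)"
    unfolding exp_coeff_Suc_sum_up exp_coeff_Suc_sum_down exp_q2T_sum[symmetric] exp_T_sum[of "A' v", symmetric]
    by (simp only: shift[of v] endom_apply[OF g])
  finally show ?thesis by (simp add: A_exp)
qed

end

section \<open>Weight decomposition\<close>

text \<open>The four generators as operators. Working with operators instead of classes in the quotient
  algebra makes the relations available as rewrite rules.\<close>
locale uq_rep = q_space +
  fixes k k' e f :: "'b \<Rightarrow> 'b"
  assumes two_nonzero: "(2::'a) \<noteq> 0"
    and endoms: "endom k" "endom k'" "endom e" "endom f"
    and k_k': "k (k' v) = v" and k'_k: "k' (k v) = v"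
    and k_e: "k (e v) = q\<^sup>2 *s e (k v)"
    and k_f: "k (f v) = inverse (q\<^sup>2) *s f (k v)"
    and e_f: "e (f v) - f (e v) = (1 / (q - inverse q)) *s (k v - k' v)"
begin

lemmas k_apply = endom_apply[OF endoms(1)]
lemmas k'_apply = endom_apply[OF endoms(2)]
lemmas e_apply = endom_apply[OF endoms(3)]
lemmas f_apply = endom_apply[OF endoms(4)]

lemma k'_f: "k' (f v) = q\<^sup>2 *s f (k' v)"
proof -
  have "f (k' v) = k' (k (f (k' v)))" by (simp only: k'_k)
  also have "\<dots> = inverse (q\<^sup>2) *s k' (f v)" by (simp only: k_f k'_apply k_k')
  finally show ?thesis using q_nonzero by simp
qed

sublocale exp_e: q_shift scale Basis q e k k'
  by unfold_locales (simp_all add: k_apply k'_apply e_apply k_k' k'_k k_e)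

sublocale exp_f: q_shift scale Basis q f k' k
  by unfold_locales (simp_all add: k_apply k'_apply f_apply k_k' k'_k k'_f)

definition \<delta> :: 'a where "\<delta> = q - inverse q"

lemma \<delta>_nonzero: "\<delta> \<noteq> 0"
  unfolding \<delta>_def by (rule q_minus_inverse_nonzero)

lemma e_f': "\<delta> *s e (f v) = \<delta> *s f (e v) + k v - k' v"
proof -
  have "\<delta> *s (e (f v) - f (e v)) = k v - k' v"
    unfolding e_f \<delta>_def[symmetric] using \<delta>_nonzero by simp
  then show ?thesis by (simp add: algebra_simps)
qed

text \<open>The usual Casimir element, multiplied by \<open>\<delta>\<^sup>2\<close> to avoid denominators.\<close>
definition casimir :: "'b \<Rightarrow> 'b" where
  "casimir v = (\<delta> * \<delta>) *s f (e v) + q *s k v + inverse q *s k' v"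

lemma endom_casimir: "endom casimir"
  by (simp add: endom_iff casimir_def k_apply k'_apply e_apply f_apply algebra_simps scale_right_distrib)

lemma casimir_e: "casimir (e v) = e (casimir v)"
proof -
  have "\<delta> *s (\<delta> *s e (f (e v))) = \<delta> *s (\<delta> *s f (e (e v)) + k (e v) - k' (e v))"
    by (simp only: e_f')
  then have "(\<delta> * \<delta>) *s e (f (e v)) = (\<delta> * \<delta>) *s f (e (e v)) + (\<delta> * q\<^sup>2) *s e (k v) - (\<delta> * inverse (q\<^sup>2)) *s e (k' v)"
    by (simp add: k_e exp_e.comm' scale_right_distrib scale_right_diff_distrib)
  then have "e (casimir v) = (\<delta> * \<delta>) *s f (e (e v)) + (\<delta> * q\<^sup>2 + q) *s e (k v)
      + (inverse q - \<delta> * inverse (q\<^sup>2)) *s e (k' v)"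
    by (simp add: casimir_def e_apply scale_left_distrib scale_left_diff_distrib algebra_simps)
  also have "\<delta> * q\<^sup>2 + q = q * q\<^sup>2"
    using q_nonzero by (simp add: \<delta>_def field_simps power2_eq_square)
  also have "inverse q - \<delta> * inverse (q\<^sup>2) = inverse q * inverse (q\<^sup>2)"
    using q_nonzero by (simp add: \<delta>_def field_simps power2_eq_square)
  finally show ?thesis by (simp add: casimir_def k_e exp_e.comm')
qed

lemma casimir_f: "casimir (f v) = f (casimir v)"
proof -
  have "\<delta> *s f (\<delta> *s e (f v)) = \<delta> *s f (\<delta> *s f (e v) + k v - k' v)"
    by (simp only: e_f')
  then have "(\<delta> * \<delta>) *s f (e (f v)) = (\<delta> * \<delta>) *s f (f (e v)) + \<delta> *s f (k v) - \<delta> *s f (k' v)"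
    by (simp add: f_apply scale_right_distrib scale_right_diff_distrib)
  then have "casimir (f v) = (\<delta> * \<delta>) *s f (f (e v)) + (\<delta> + q * inverse (q\<^sup>2)) *s f (k v)
      + (inverse q * q\<^sup>2 - \<delta>) *s f (k' v)"
    by (simp add: casimir_def k_f k'_f scale_left_distrib scale_left_diff_distrib algebra_simps)
  also have "\<delta> + q * inverse (q\<^sup>2) = q"
    using q_nonzero by (simp add: \<delta>_def field_simps power2_eq_square)
  also have "inverse q * q\<^sup>2 - \<delta> = inverse q"
    using q_nonzero by (simp add: \<delta>_def field_simps power2_eq_square)
  finally show ?thesis by (simp add: casimir_def f_apply)
qed

lemma casimir_k: "casimir (k v) = k (casimir v)"
  using q_nonzero by (simp add: casimir_def k_apply k_e k_f k_k' k'_k e_apply f_apply)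

text \<open>On the subspace where \<open>k = \<kappa>\<close>, the condition \<open>D m = 0\<close> says that \<open>casimir\<close> takes the value that it has on
  a highest weight vector of \<open>k\<close>-eigenvalue \<open>q\<^bsup>2m\<^esup> \<kappa>\<close>.\<close>
definition D :: "int \<Rightarrow> 'b \<Rightarrow> 'b" where
  "D m v = casimir v - q powi (2 * m + 1) *s k v - q powi (- (2 * m + 1)) *s k' v"

lemma endom_D: "endom (D m)"
  by (simp add: endom_iff D_def endom_apply[OF endom_casimir] k_apply k'_apply algebra_simps scale_right_distrib)

lemmas D_apply = endom_apply[OF endom_D]

lemma powi_add: "q powi (m + n) = q powi m * q powi n"
  using q_nonzero by (simp add: power_int_add)

lemma D_k: "D m (k v) = k (D m v)"
  by (simp add: D_def casimir_k k_apply k_k' k'_k)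

lemma D_e: "D m (e v) = e (D (m + 1) v)"
proof -
  have "q powi (2 * (m + 1) + 1) = q powi (2 * m + 1) * q\<^sup>2"
    "q powi (- (2 * (m + 1) + 1)) = q powi (- (2 * m + 1)) * inverse (q\<^sup>2)"
    using powi_add[of "2 * m + 1" 2] powi_add[of "- (2 * m + 1)" "- 2"]
    by (simp_all add: power_int_minus algebra_simps)
  then show ?thesis
    by (simp only: D_def casimir_e e_apply k_e exp_e.comm' scale_scale)
qed

lemma D_f: "D m (f v) = f (D (m - 1) v)"
proof -
  have "q powi (2 * (m - 1) + 1) = q powi (2 * m + 1) * inverse (q\<^sup>2)"
    "q powi (- (2 * (m - 1) + 1)) = q powi (- (2 * m + 1)) * q\<^sup>2"
    using powi_add[of "2 * m + 1" "- 2"] powi_add[of "- (2 * m + 1)" 2]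
    by (simp_all add: power_int_minus algebra_simps)
  then show ?thesis
    by (simp only: D_def casimir_f f_apply k_f k'_f scale_scale)
qed

text \<open>The next two identities, with \<open>D_e\<close> and \<open>D_f\<close>, let \<open>f\<^sup>n e\<^sup>n\<close> and \<open>e\<^sup>n f\<^sup>n\<close> be
  written as products of the commuting operators \<open>D m\<close>.\<close>
lemma D_0: "D 0 v = (\<delta> * \<delta>) *s f (e v)"
  by (simp add: D_def casimir_def power_int_minus)

lemma D_minus_1: "D (- 1) v = (\<delta> * \<delta>) *s e (f v)"
proof -
  have "(\<delta> * \<delta>) *s e (f v) = \<delta> *s (\<delta> *s f (e v) + k v - k' v)"
    by (simp flip: e_f')
  also have "\<dots> = (\<delta> * \<delta>) *s f (e v) + \<delta> *s k v - \<delta> *s k' v"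
    by (simp add: scale_right_distrib scale_right_diff_distrib)
  also have "\<dots> = D (- 1) v"
    by (simp add: D_def casimir_def \<delta>_def power_int_minus scale_left_diff_distrib)
  finally show ?thesis ..
qed

text \<open>The factorization behind all comparisons of two factors: \<open>D m\<close> and \<open>D n\<close> with \<open>m \<noteq> n\<close> agree exactly where
  \<open>k\<^sup>2 = q\<^bsup>-2m-2n-2\<^esup>\<close>.\<close>
lemma D_diff: "D m v = D n v + (q powi (2 * n + 1) - q powi (2 * m + 1)) *s
  (k v - q powi (- (2 * m + 2 * n + 2)) *s k' v)"
proof -
  have "q powi (2 * n + 1) * q powi (- (2 * m + 2 * n + 2)) = q powi (- (2 * m + 1))"
    "q powi (2 * m + 1) * q powi (- (2 * m + 2 * n + 2)) = q powi (- (2 * n + 1))"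
    by (simp_all add: algebra_simps flip: powi_add)
  then show ?thesis
    by (simp add: D_def scale_right_diff_distrib scale_left_diff_distrib left_diff_distrib)
qed

primrec D_prod :: "(nat \<Rightarrow> int) \<Rightarrow> nat \<Rightarrow> 'b \<Rightarrow> 'b" where
  "D_prod h 0 v = v"
| "D_prod h (Suc n) v = D_prod h n (D (h n) v)"

lemma endom_Dprod: "endom (D_prod h n)"
  by (induction n) (simp_all add: endom_iff D_apply)

lemma D_prod_k: "D_prod h n (k v) = k (D_prod h n v)"
  by (induction n arbitrary: v) (simp_all add: D_k)

lemma D_e_funpow: "D m ((e ^^ n) v) = (e ^^ n) (D (m + int n) v)"
  by (induction n arbitrary: m) (simp_all add: D_e algebra_simps)

lemma D_f_funpow: "D m ((f ^^ n) v) = (f ^^ n) (D (m - int n) v)"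
  by (induction n arbitrary: m) (simp_all add: D_f algebra_simps)

lemma D_prod_up: "D_prod int n v = (\<delta> * \<delta>) ^ n *s (f ^^ n) ((e ^^ n) v)"
proof (induction n arbitrary: v)
  case (Suc n)
  have "(e ^^ n) (D (int n) v) = (\<delta> * \<delta>) *s f ((e ^^ Suc n) v)"
    using D_e_funpow[of "0" n v] by (simp add: D_0)
  then have "(f ^^ n) ((e ^^ n) (D (int n) v)) = (\<delta> * \<delta>) *s (f ^^ Suc n) ((e ^^ Suc n) v)"
    by (simp only: endom_apply[OF endom_funpow[OF endoms(4)]] funpow_Suc_right[of n f] comp_apply)
  then show ?case by (simp add: Suc mult.commute del: funpow.simps)
qed simp

lemma D_prod_down: "D_prod (\<lambda>j. - 1 - int j) n v = (\<delta> * \<delta>) ^ n *s (e ^^ n) ((f ^^ n) v)"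
proof (induction n arbitrary: v)
  case (Suc n)
  have "(f ^^ n) (D (- 1 - int n) v) = (\<delta> * \<delta>) *s e ((f ^^ Suc n) v)"
    using D_f_funpow[of "- 1" n v] by (simp add: D_minus_1)
  then have "(e ^^ n) ((f ^^ n) (D (- 1 - int n) v)) = (\<delta> * \<delta>) *s (e ^^ Suc n) ((f ^^ Suc n) v)"
    by (simp only: endom_apply[OF endom_funpow[OF endoms(3)]] funpow_Suc_right[of n e] comp_apply)
  then show ?case by (simp add: Suc mult.commute del: funpow.simps)
qed simp

text \<open>The joint eigenvectors at the points where the curve \<open>D m = 0\<close> meets one of the curves
  \<open>D (- 1 - j) = 0\<close> with \<open>j < t\<close>: there \<open>k\<^sup>2 = q\<^bsup>2(j - m)\<^esup>\<close>.\<close>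
definition joint :: "nat \<Rightarrow> nat \<Rightarrow> 'b set" where
  "joint t m = {v. D (int m) v = 0 \<and> (\<exists>j<t. \<exists>\<epsilon>\<in>{1, -1}. k v = (\<epsilon> * q powi (int j - int m)) *s v)}"

lemma jointE:
  assumes "v \<in> joint t m"
  obtains j \<epsilon> where "D (int m) v = 0" "j < t" "\<epsilon> \<in> {1, -1}" "k v = (\<epsilon> * q powi (int j - int m)) *s v"
proof -
  from assms have "D (int m) v = 0" and *: "\<exists>j<t. \<exists>\<epsilon>\<in>{1, -1}. k v = (\<epsilon> * q powi (int j - int m)) *s v"
    by (simp_all only: joint_def mem_Collect_eq)
  from * show thesis by (elim exE conjE bexE) (rule that[OF \<open>D (int m) v = 0\<close>])
qed

lemma span_joint_kernel: "v \<in> span (joint t m) \<Longrightarrow> D (int m) v = 0"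
  by (induction rule: span_induct_alt) (auto simp: D_apply joint_def)

text \<open>On the kernel of \<open>D m\<close> the factor \<open>D (- 1 - t)\<close> is a nonzero multiple of \<open>k\<inverse> (k\<^sup>2 - q\<^bsup>2(t - m)\<^esup>)\<close>, and
  distinct \<open>t\<close> give distinct eigenvalues of \<open>k\<^sup>2\<close>. By induction the image of \<open>u\<close> under
  \<open>k\<^sup>2 - q\<^bsup>2(t - m)\<^esup>\<close> lies in the span of the earlier eigenvectors, on which this operator is invertible; subtracting a preimage from \<open>u\<close> leaves a
  vector with \<open>k\<^sup>2 = q\<^bsup>2(t - m)\<^esup>\<close>, which splits into two eigenvectors of \<open>k\<close> because \<open>2 \<noteq> 0\<close>.\<close>
lemma kernel_decomposition:
  assumes "D (int m) u = 0" "D_prod (\<lambda>j. - 1 - int j) t u = 0"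
  shows "u \<in> span (joint t m)"
  using assms
proof (induction t arbitrary: u)
  case 0
  then show ?case by (simp add: span_zero)
next
  case (Suc t)
  define \<kappa> where "\<kappa> = q powi (int t - int m)"
  define Z where "Z v = k (k v) - (\<kappa> * \<kappa>) *s v" for v
  have Z: "endom Z"
    by (simp add: endom_iff Z_def k_apply algebra_simps scale_right_distrib)
  have \<kappa>: "\<kappa> \<noteq> 0" using q_nonzero by (simp add: \<kappa>_def)
  have \<kappa>2: "q powi (- (2 * (- 1 - int t) + 2 * int m + 2)) = \<kappa> * \<kappa>"
    unfolding \<kappa>_def powi_add[symmetric] by (rule arg_cong[where f = "power_int q"]) simp
  define c where "c = q powi (2 * int m + 1) - q powi (2 * (- 1 - int t) + 1)"
  have c: "c \<noteq> 0" by (simp add: c_def q_powi_inject)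
  have "k (D (- 1 - int t) u) = c *s Z u"
    unfolding D_diff[of "- 1 - int t" u "int m"] Suc.prems(1) c_def[symmetric] \<kappa>2
    by (simp add: Z_def k_apply k_k')
  then have "c *s D_prod (\<lambda>j. - 1 - int j) t (Z u) = 0"
    using Suc.prems(2) D_prod_k[of "\<lambda>j. - 1 - int j" t "D (- 1 - int t) u"]
    by (simp add: k_apply endom_apply[OF endom_Dprod])
  then have "D_prod (\<lambda>j. - 1 - int j) t (Z u) = 0" using c by simp
  moreover have "D (int m) (Z u) = 0" by (simp add: Z_def D_apply D_k Suc.prems k_apply)
  ultimately have "Z u \<in> span (joint t m)" by (intro Suc.IH)
  moreover have "\<exists>a. a \<noteq> 0 \<and> Z x = a *s x" if x: "x \<in> joint t m" for x
  proof -
    from x obtain j \<epsilon> where "D (int m) x = 0"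
      and j: "j < t" "\<epsilon> \<in> {1, -1}" "k x = (\<epsilon> * q powi (int j - int m)) *s x"
      by (rule jointE)
    have "Z x = (q powi (2 * (int j - int m)) - q powi (2 * (int t - int m))) *s x"
      unfolding mult_2 powi_add \<kappa>_def[symmetric] Z_def scale_left_diff_distrib
      using j by (auto simp: k_apply)
    moreover have "q powi (2 * (int j - int m)) - q powi (2 * (int t - int m)) \<noteq> 0"
      using j by (simp add: q_powi_inject)
    ultimately show ?thesis by blast
  qed
  ultimately obtain u' where u': "u' \<in> span (joint t m)" "Z u' = Z u"
    using eigen_span_surj[OF Z] by metis
  define w where "w = u - u'"
  have "Z w = 0" using u' by (simp add: w_def endom_apply[OF Z])
  then have kk: "k (k w) = (\<kappa> * \<kappa>) *s w" by (simp add: Z_def)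
  have Dw: "D (int m) w = 0"
    using Suc.prems span_joint_kernel[OF u'(1)] by (simp add: w_def D_apply)
  have part: "w + (\<epsilon> / \<kappa>) *s k w \<in> joint (Suc t) m" if "\<epsilon> \<in> {1, -1}" for \<epsilon>
  proof -
    have "k (w + (\<epsilon> / \<kappa>) *s k w) = (\<epsilon> * \<kappa>) *s (w + (\<epsilon> / \<kappa>) *s k w)"
      using that \<kappa> by (auto simp: k_apply kk scale_right_distrib)
    then show ?thesis
      using that by (auto simp: joint_def D_apply D_k Dw k_apply \<kappa>_def intro!: exI[of _ t])
  qed
  have "(1 / 2) *s ((w + (1 / \<kappa>) *s k w) + (w + (- 1 / \<kappa>) *s k w)) \<in> span (joint (Suc t) m)"
    using part[of 1] part[of "- 1"] by (intro span_scale span_add span_base) auto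
  also have "(1 / 2) *s ((w + (1 / \<kappa>) *s k w) + (w + (- 1 / \<kappa>) *s k w)) = w"
  proof -
    have "(w + (1 / \<kappa>) *s k w) + (w + (- 1 / \<kappa>) *s k w) = 2 *s w"
      by (simp add: scale_left_distrib[of 1 1, simplified])
    then show ?thesis using two_nonzero by simp
  qed
  finally have "w \<in> span (joint (Suc t) m)" .
  moreover have "u' \<in> span (joint (Suc t) m)"
    using u'(1) span_mono[of "joint t m" "joint (Suc t) m"] by (auto simp: joint_def less_Suc_eq)
  ultimately have "w + u' \<in> span (joint (Suc t) m)" by (rule span_add)
  then show ?case by (simp add: w_def)
qed

text \<open>The decisive point is that \<open>D n\<close> is invertible on the joint eigenvectors found for \<open>m < n\<close>. It has the
  eigenvalue 0 there only if \<open>k\<^sup>2 = q\<^bsup>-2m-2n-2\<^esup>\<close>, whereas \<open>k\<^sup>2 = q\<^bsup>2(j - m)\<^esup>\<close> with \<open>j \<ge> 0\<close>. So \<open>v\<close> can be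
  corrected to a vector in the kernel of \<open>D n\<close>, to which \<open>kernel_decomposition\<close> applies.\<close>
lemma decomposition:
  assumes "\<And>u. D_prod (\<lambda>j. - 1 - int j) s u = 0" "D_prod int n v = 0"
  shows "v \<in> span (\<Union>m<n. joint s m)"
  using assms(2)
proof (induction n arbitrary: v)
  case 0
  then show ?case by (simp add: span_zero)
next
  case (Suc n)
  have "D (int n) v \<in> span (\<Union>m<n. joint s m)"
    using Suc by simp
  moreover have "\<exists>a. a \<noteq> 0 \<and> D (int n) x = a *s x" if "x \<in> (\<Union>m<n. joint s m)" for x
  proof -
    obtain m where m: "m < n" "x \<in> joint s m"
      using \<open>x \<in> (\<Union>m<n. joint s m)\<close> by auto
    from m(2) obtain j \<epsilon> where Dx: "D (int m) x = 0" and "j < s" and \<epsilon>_cases: "\<epsilon> \<in> {1, -1}"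
      and kx: "k x = (\<epsilon> * q powi (int j - int m)) *s x"
      by (rule jointE)
    have \<epsilon>: "\<epsilon> * \<epsilon> = 1" "\<epsilon> \<noteq> 0" using \<epsilon>_cases by auto
    have "x = (\<epsilon> * q powi (int j - int m)) *s k' x"
      using k'_k[of x] by (simp add: kx k'_apply)
    then have "(\<epsilon> * q powi (int m - int j)) *s x = (\<epsilon> * \<epsilon> * (q powi (int m - int j) * q powi (int j - int m))) *s k' x"
      by (metis scale_scale mult.assoc mult.left_commute)
    then have k'x: "k' x = (\<epsilon> * q powi (int m - int j)) *s x"
      by (simp add: \<epsilon> flip: powi_add)
    have "D (int n) x = ((q powi (2 * int m + 1) - q powi (2 * int n + 1)) *
      (\<epsilon> * (q powi (int j - int m) - q powi (- (2 * int n + 2 * int m + 2) + (int m - int j))))) *s x"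
    proof -
      \<comment> \<open>\<open>k\<close> and \<open>k'\<close> act on \<open>x\<close> by mutually inverse scalars with the same sign \<open>\<epsilon>\<close>, which factors out.\<close>
      have factor: "a *s ((\<epsilon> * b) *s x - c *s (\<epsilon> * d) *s x) = (a * (\<epsilon> * (b - c * d))) *s x" for a b c d
      proof -
        have "a * (\<epsilon> * b - c * (\<epsilon> * d)) = a * (\<epsilon> * (b - c * d))"
          by (simp add: algebra_simps)
        then show ?thesis
          by (simp only: scale_right_diff_distrib scale_scale scale_left_diff_distrib[symmetric])
      qed
      show ?thesis
        unfolding D_diff[of "int n" x "int m"] Dx kx k'x powi_add[of "- (2 * int n + 2 * int m + 2)"]
        by (simp only: factor add_0)
    qed
    moreover have "(q powi (2 * int m + 1) - q powi (2 * int n + 1)) *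
      (\<epsilon> * (q powi (int j - int m) - q powi (- (2 * int n + 2 * int m + 2) + (int m - int j)))) \<noteq> 0"
      using m(1) \<epsilon> by (simp add: q_powi_inject)
    ultimately show ?thesis by blast
  qed
  ultimately obtain v' where v': "v' \<in> span (\<Union>m<n. joint s m)" "D (int n) v' = D (int n) v"
    using eigen_span_surj[OF endom_D] by metis
  have "v - v' \<in> span (joint s n)"
    using v' assms(1) by (intro kernel_decomposition) (simp_all add: D_apply)
  moreover have "span (joint s n) \<subseteq> span (\<Union>m<Suc n. joint s m)"
    by (rule span_mono, rule UN_upper) simp
  moreover have "span (\<Union>m<n. joint s m) \<subseteq> span (\<Union>m<Suc n. joint s m)"
    by (rule span_mono, rule UN_mono) auto
  ultimately have "(v - v') + v' \<in> span (\<Union>m<Suc n. joint s m)"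
    using v'(1) by (intro span_add) blast+
  then show ?case by simp
qed

definition weight_vectors :: "int set \<Rightarrow> 'b set" where
  "weight_vectors M = {v. \<exists>m\<in>M. \<exists>\<epsilon>\<in>{1, -1}. k v = (\<epsilon> * q powi m) *s v}"

theorem weight_decomposition: "\<exists>M. finite M \<and> span (weight_vectors M) = UNIV"
proof (intro exI conjI)
  let ?M = "{- int exp_e.nil_index..int exp_f.nil_index}"
  show "finite ?M" by simp
  have "v \<in> span (weight_vectors ?M)" for v
  proof -
    have "v \<in> span (\<Union>m<exp_e.nil_index. joint exp_f.nil_index m)"
      by (rule decomposition)
         (simp_all add: D_prod_up D_prod_down exp_e.funpow_nil_index exp_f.funpow_nil_index
            endom_apply[OF endom_funpow[OF endoms(3)]] endom_apply[OF endom_funpow[OF endoms(4)]])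
    moreover have "(\<Union>m<exp_e.nil_index. joint exp_f.nil_index m) \<subseteq> weight_vectors ?M"
    proof
      fix v assume "v \<in> (\<Union>m<exp_e.nil_index. joint exp_f.nil_index m)"
      then obtain m where m: "m < exp_e.nil_index" "v \<in> joint exp_f.nil_index m" by auto
      from m(2) obtain j \<epsilon> where "D (int m) v = 0" "j < exp_f.nil_index" "\<epsilon> \<in> {1, -1}"
        "k v = (\<epsilon> * q powi (int j - int m)) *s v"
        by (rule jointE)
      moreover have "int j - int m \<in> ?M" using m(1) \<open>j < exp_f.nil_index\<close> by simp
      ultimately show "v \<in> weight_vectors ?M"
        unfolding weight_vectors_def mem_Collect_eq by (intro bexI)
    qed
    ultimately show ?thesis using span_mono by blast
  qed
  then show "span (weight_vectors ?M) = UNIV" by blast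
qed

end

section \<open>The operators \<Psi> and \<Omega>\<close>

lemma exists_interpolating_poly:
  fixes c :: "'a::field \<Rightarrow> 'a"
  assumes "finite S"
  shows "\<exists>p. \<forall>x\<in>S. poly p x = c x"
  using assms
proof (induction S)
  case (insert a S)
  then obtain p where p: "\<And>x. x \<in> S \<Longrightarrow> poly p x = c x" by blast
  define r where "r = (\<Prod>x\<in>S. [:- x, 1:])"
  have r: "poly r y = 0 \<longleftrightarrow> y \<in> S" for y
    using insert.hyps by (auto simp: r_def poly_prod)
  have "poly (p + smult ((c a - poly p a) / poly r a) r) x = c x" if "x \<in> insert a S" for x
    using that insert.hyps r[of x] p by (cases "x = a") auto
  then show ?case by blast
qed simp

text \<open>The eigenvalue ratio between neighbouring weights; it makes the intertwining relations of \<open>\<Psi>\<close> with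
  \<open>e\<close> and \<open>f\<close> hold.\<close>
lemma Psi_coeff_add_2:
  assumes "q \<noteq> 0"
  shows "Psi_coeff q (m + 2) = q powi (- 2 * m - 2) * Psi_coeff q m"
proof (cases "even m")
  case True
  then obtain n where n: "m = 2 * n" by blast
  have "(m + 2)\<^sup>2 div 2 = 2 * (n + 1)\<^sup>2" "m\<^sup>2 div 2 = 2 * n\<^sup>2"
    by (simp_all add: n power2_eq_square algebra_simps)
  moreover have "q powi (- (2 * (n + 1)\<^sup>2)) = q powi (- 2 * m - 2) * q powi (- (2 * n\<^sup>2))"
    unfolding power_int_add[OF disjI1[OF assms], symmetric]
    by (rule arg_cong[where f = "power_int q"]) (simp add: n power2_eq_square algebra_simps)
  ultimately show ?thesis using True by (simp only: Psi_coeff_def if_True even_add) simp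
next
  case False
  then obtain n where n: "m = 2 * n + 1" by (elim oddE)
  have "1 - (m + 2)\<^sup>2 = 2 * (- 2 * n\<^sup>2 - 6 * n - 4)" "1 - m\<^sup>2 = 2 * (- 2 * n\<^sup>2 - 2 * n)"
    by (simp_all add: n power2_eq_square algebra_simps)
  then have "(1 - (m + 2)\<^sup>2) div 2 = - 2 * n\<^sup>2 - 6 * n - 4" "(1 - m\<^sup>2) div 2 = - 2 * n\<^sup>2 - 2 * n"
    by (simp_all only: nonzero_mult_div_cancel_left[OF numeral_neq_zero])
  moreover have "q powi (- 2 * n\<^sup>2 - 6 * n - 4) = q powi (- 2 * m - 2) * q powi (- 2 * n\<^sup>2 - 2 * n)"
    unfolding power_int_add[OF disjI1[OF assms], symmetric]
    by (rule arg_cong[where f = "power_int q"]) (simp add: n)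
  ultimately show ?thesis using False by (simp only: Psi_coeff_def if_False even_add) simp
qed

lemma Psi_coeff_nonzero: "q \<noteq> 0 \<Longrightarrow> Psi_coeff q m \<noteq> 0"
  by (simp add: Psi_coeff_def)

context uq_rep
begin

definition weight_operator :: "(int \<Rightarrow> 'a) \<Rightarrow> ('b \<Rightarrow> 'b) \<Rightarrow> bool" where
  "weight_operator \<psi> P \<longleftrightarrow> endom P \<and>
    (\<forall>\<epsilon>\<in>{1, -1}. \<forall>m v. k v = (\<epsilon> * q powi m) *s v \<longrightarrow> P v = \<psi> m *s v)"

text \<open>The sign is lost on squaring, but the weight is not, as \<open>q\<^sup>2\<close> has infinite order.\<close>
lemma weight_unique:
  assumes "\<epsilon> \<in> {1, -1}" "\<epsilon>' \<in> {1, -1}" "\<epsilon> * q powi m = \<epsilon>' * q powi m'"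
  shows "m = m'"
proof -
  have "(\<epsilon> * q powi m) * (\<epsilon> * q powi m) = (\<epsilon>' * q powi m') * (\<epsilon>' * q powi m')"
    using assms(3) by simp
  then have "q powi m * q powi m = q powi m' * q powi m'"
    using assms(1,2) by auto
  then have "q powi (m + m) = q powi (m' + m')" by (simp only: powi_add)
  then show ?thesis by (simp add: q_powi_inject)
qed

lemma endom_eq_on_weights:
  assumes "endom S" "endom T"
    and eq: "\<And>v m \<epsilon>. \<epsilon> \<in> {1, -1} \<Longrightarrow> k v = (\<epsilon> * q powi m) *s v \<Longrightarrow> S v = T v"
  shows "S v = T v"
proof -
  obtain M where M: "span (weight_vectors M) = UNIV" using weight_decomposition by blast
  show ?thesis
  proof (rule endom_eq_on_span[OF assms(1,2) _ M])
    fix v assume "v \<in> weight_vectors M"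
    then show "S v = T v" unfolding weight_vectors_def using eq by blast
  qed
qed

lemma weight_operator_unique:
  assumes "weight_operator \<psi> P" "weight_operator \<psi> P'"
  shows "P = P'"
proof
  fix v
  show "P v = P' v"
  proof (rule endom_eq_on_weights[where S = P and T = P'])
    show "endom P" "endom P'" using assms by (simp_all add: weight_operator_def)
    fix v m \<epsilon> assume "\<epsilon> \<in> {1, -1}" "k v = (\<epsilon> * q powi m) *s v"
    then have "P v = \<psi> m *s v" "P' v = \<psi> m *s v"
      using assms unfolding weight_operator_def by blast+
    then show "P v = P' v" by simp
  qed
qed

text \<open>The operator is a polynomial in \<open>k\<close> that interpolates \<open>\<psi>\<close> at the finitely many eigenvalues of a spanning
  set of weight vectors. It is also correct on weight vectors of any other weight, because these are zero: the
  polynomial \<open>r\<close> that vanishes exactly at the chosen eigenvalues kills the whole space.\<close>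
lemma exists_weight_operator: "\<exists>P. weight_operator \<psi> P"
proof -
  obtain M where M: "finite M" "span (weight_vectors M) = UNIV" using weight_decomposition by blast
  define S where "S = (\<lambda>(\<epsilon>, m). \<epsilon> * q powi m) ` ({1, -1} \<times> M)"
  have fS: "finite S" using M(1) by (simp add: S_def)
  define r where "r = (\<Prod>x\<in>S. [:- x, 1:])"
  have r: "poly r y = 0 \<longleftrightarrow> y \<in> S" for y
    using fS by (auto simp: r_def poly_prod)
  have r0: "poly_op r k v = 0" for v
  proof (rule endom_eq_on_span[where R = "poly_op r k" and T = "\<lambda>_. 0"])
    show "endom (\<lambda>_. 0)" by (simp add: endom_iff)
    fix v assume "v \<in> weight_vectors M"
    then obtain m \<epsilon> where m: "m \<in> M" "\<epsilon> \<in> {1, -1}" "k v = (\<epsilon> * q powi m) *s v"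
      unfolding weight_vectors_def by blast
    then have "\<epsilon> * q powi m \<in> S" unfolding S_def by force
    then show "poly_op r k v = 0"
      using poly_op_eigen[OF endoms(1) m(3)] r by simp
  qed (fact endom_poly_op[OF endoms(1)] M(2))+
  define c where "c x = \<psi> (THE m. \<exists>\<epsilon>\<in>{1, -1}. x = \<epsilon> * q powi m)" for x
  have c: "c (\<epsilon> * q powi m) = \<psi> m" if "\<epsilon> \<in> {1, -1}" for \<epsilon> m
  proof -
    have "(THE m'. \<exists>\<epsilon>'\<in>{1, -1}. \<epsilon> * q powi m = \<epsilon>' * q powi m') = m"
    proof (rule the_equality)
      show "\<exists>\<epsilon>'\<in>{1, -1}. \<epsilon> * q powi m = \<epsilon>' * q powi m" using that by blast
    qed (use that weight_unique in blast)
    then show ?thesis by (simp add: c_def)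
  qed
  obtain p where p: "\<And>x. x \<in> S \<Longrightarrow> poly p x = c x"
    using exists_interpolating_poly[OF fS] by blast
  have "poly_op p k v = \<psi> m *s v" if \<epsilon>: "\<epsilon> \<in> {1, -1}" and v: "k v = (\<epsilon> * q powi m) *s v" for \<epsilon> m v
  proof (cases "v = 0")
    case True
    then show ?thesis by (simp add: endom_apply[OF endom_poly_op[OF endoms(1)]])
  next
    case False
    then have "\<epsilon> * q powi m \<in> S"
      using r0[of v] poly_op_eigen[OF endoms(1) v, of r] r by simp
    then show ?thesis
      using poly_op_eigen[OF endoms(1) v, of p] p c[OF \<epsilon>] by simp
  qed
  then have "weight_operator \<psi> (poly_op p k)"
    unfolding weight_operator_def using endom_poly_op[OF endoms(1)] by blast
  then show ?thesis by blast
qed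

definition \<Psi> :: "'b \<Rightarrow> 'b" where "\<Psi> = (THE P. weight_operator (Psi_coeff q) P)"

lemma weight_operator_\<Psi>: "weight_operator (Psi_coeff q) \<Psi>"
proof -
  obtain P where P: "weight_operator (Psi_coeff q) P" using exists_weight_operator by blast
  show ?thesis unfolding \<Psi>_def by (rule theI[where P = "weight_operator (Psi_coeff q)", OF P]) (rule weight_operator_unique[OF _ P])
qed

lemma endom_\<Psi>: "endom \<Psi>"
  using weight_operator_\<Psi> by (simp add: weight_operator_def)

lemmas \<Psi>_apply = endom_apply[OF endom_\<Psi>]

lemma \<Psi>_weight: "\<epsilon> \<in> {1, -1} \<Longrightarrow> k v = (\<epsilon> * q powi m) *s v \<Longrightarrow> \<Psi> v = Psi_coeff q m *s v"
  using weight_operator_\<Psi> unfolding weight_operator_def by blast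

lemma k'_weight:
  assumes "\<epsilon> \<in> {1, -1}" "k v = (\<epsilon> * q powi m) *s v"
  shows "k' v = (\<epsilon> * q powi (- m)) *s v"
proof -
  have "k' v = k' ((\<epsilon> * q powi (- m)) *s (\<epsilon> * q powi m) *s v)"
    using assms(1) by (auto simp: mult.assoc simp flip: powi_add)
  also have "\<dots> = (\<epsilon> * q powi (- m)) *s v"
    by (simp only: assms(2)[symmetric] k'_apply k'_k)
  finally show ?thesis .
qed

lemma e_weight:
  assumes "k v = (\<epsilon> * q powi m) *s v"
  shows "k (e v) = (\<epsilon> * q powi (m + 2)) *s e v"
  by (simp add: k_e assms e_apply powi_add mult_ac)

lemma f_weight:
  assumes "k v = (\<epsilon> * q powi m) *s v"
  shows "k (f v) = (\<epsilon> * q powi (m - 2)) *s f v"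
  using powi_add[of m "- 2"] by (simp add: k_f assms f_apply power_int_minus mult_ac)

text \<open>The weight operator with the inverse eigenvalues is a left inverse.\<close>
lemma inj_\<Psi>: "inj \<Psi>"
proof -
  obtain P where P: "weight_operator (\<lambda>m. inverse (Psi_coeff q m)) P"
    using exists_weight_operator by blast
  then have "endom P" by (simp add: weight_operator_def)
  have "P (\<Psi> v) = v" for v
  proof (rule endom_eq_on_weights[where S = "\<lambda>v. P (\<Psi> v)" and T = "\<lambda>v. v"])
    show "endom (\<lambda>v. P (\<Psi> v))" "endom (\<lambda>v. v)"
      using \<open>endom P\<close> endom_\<Psi> by (simp_all add: endom_iff)
    fix v m \<epsilon> assume v: "\<epsilon> \<in> {1, -1}" "k v = (\<epsilon> * q powi m) *s v"
    have "P v = inverse (Psi_coeff q m) *s v"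
      using P v unfolding weight_operator_def by blast
    then show "P (\<Psi> v) = v"
      using Psi_coeff_nonzero[OF q_nonzero, of m] by (simp add: \<Psi>_weight[OF v] endom_apply[OF \<open>endom P\<close>])
  qed
  then show ?thesis by (rule inj_on_inverseI)
qed

lemma \<Psi>_k: "\<Psi> (k v) = k (\<Psi> v)"
proof (rule endom_eq_on_weights[where S = "\<lambda>v. \<Psi> (k v)" and T = "\<lambda>v. k (\<Psi> v)"])
  show "endom (\<lambda>v. \<Psi> (k v))" "endom (\<lambda>v. k (\<Psi> v))"
    by (simp_all add: endom_iff \<Psi>_apply k_apply)
  fix v m \<epsilon> assume v: "\<epsilon> \<in> {1, -1}" "k v = (\<epsilon> * q powi m) *s v"
  then show "\<Psi> (k v) = k (\<Psi> v)"
    by (simp add: \<Psi>_weight[OF v] \<Psi>_apply k_apply mult_ac)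
qed

lemma \<Psi>_k': "\<Psi> (k' v) = k' (\<Psi> v)"
  using \<Psi>_k[of "k' v"] by (simp add: k_k' k'_k)

lemma \<Psi>_e: "\<Psi> (e v) = k' (e (k' (\<Psi> v)))"
proof (rule endom_eq_on_weights[where S = "\<lambda>v. \<Psi> (e v)" and T = "\<lambda>v. k' (e (k' (\<Psi> v)))"])
  show "endom (\<lambda>v. \<Psi> (e v))" "endom (\<lambda>v. k' (e (k' (\<Psi> v))))"
    by (simp_all add: endom_iff \<Psi>_apply k'_apply e_apply)
  fix v m \<epsilon> assume v: "\<epsilon> \<in> {1, -1}" "k v = (\<epsilon> * q powi m) *s v"
  have "k' (e (k' (\<Psi> v))) = (Psi_coeff q m * (\<epsilon> * q powi (- m)) * (\<epsilon> * q powi (- (m + 2)))) *s e v"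
    by (simp only: \<Psi>_weight[OF v] k'_apply k'_weight[OF v] e_apply k'_weight[OF v(1) e_weight[OF v(2)]] scale_scale mult.assoc)
  also have "Psi_coeff q m * (\<epsilon> * q powi (- m)) * (\<epsilon> * q powi (- (m + 2))) = (\<epsilon> * \<epsilon>) * q powi (- m + - (m + 2)) * Psi_coeff q m"
    by (simp only: powi_add mult_ac)
  also have "\<dots> = Psi_coeff q (m + 2)"
    using v(1) by (auto simp: Psi_coeff_add_2[OF q_nonzero])
  finally show "\<Psi> (e v) = k' (e (k' (\<Psi> v)))"
    using \<Psi>_weight[OF v(1) e_weight[OF v(2)]] by simp
qed

lemma \<Psi>_f: "\<Psi> (f v) = k (f (k (\<Psi> v)))"
proof (rule endom_eq_on_weights[where S = "\<lambda>v. \<Psi> (f v)" and T = "\<lambda>v. k (f (k (\<Psi> v)))"])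
  show "endom (\<lambda>v. \<Psi> (f v))" "endom (\<lambda>v. k (f (k (\<Psi> v))))"
    by (simp_all add: endom_iff \<Psi>_apply k_apply f_apply)
  fix v m \<epsilon> assume v: "\<epsilon> \<in> {1, -1}" "k v = (\<epsilon> * q powi m) *s v"
  have "k (f (k (\<Psi> v))) = (Psi_coeff q m * (\<epsilon> * q powi m) * (\<epsilon> * q powi (m - 2))) *s f v"
    by (simp only: \<Psi>_weight[OF v] k_apply v(2) f_apply f_weight[OF v(2)] scale_scale mult.assoc)
  also have "Psi_coeff q m * (\<epsilon> * q powi m) * (\<epsilon> * q powi (m - 2)) = (\<epsilon> * \<epsilon>) * q powi (m + (m - 2)) * Psi_coeff q m"
    by (simp only: powi_add mult_ac)
  also have "\<dots> = Psi_coeff q (m - 2)"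
    using v(1) Psi_coeff_add_2[OF q_nonzero, of "m - 2"] q_nonzero
    by (auto simp: algebra_simps simp flip: power_int_add)
  finally show "\<Psi> (f v) = k (f (k (\<Psi> v)))"
    using \<Psi>_weight[OF v(1) f_weight[OF v(2)]] by simp
qed

text \<open>The action of \<open>q (1 - x y) / (q - q\<inverse>)\<close>.\<close>
definition n_z :: "'b \<Rightarrow> 'b" where "n_z v = - q *s k (f v)"

lemma endom_n_z: "endom n_z"
  by (simp add: endom_iff n_z_def k_apply f_apply scale_right_distrib mult.commute)

lemma k'_n_z: "k' (n_z v) = q\<^sup>2 *s n_z (k' v)"
  using q_nonzero by (simp add: n_z_def k'_apply k'_k k_f k_k' k'_f)

sublocale exp_n: q_shift scale Basis q n_z k' k
  by unfold_locales (simp_all add: endom_apply[OF endom_n_z] k_apply k'_apply k_k' k'_k k'_n_z)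

definition y :: "'b \<Rightarrow> 'b" where "y v = k' v + \<delta> *s f v"
definition z :: "'b \<Rightarrow> 'b" where "z v = k' v - (q * \<delta>) *s k' (e v)"

definition \<Omega> :: "'b \<Rightarrow> 'b" where "\<Omega> v = exp_n.exp_T (\<Psi> (exp_e.exp_T v))"

lemma q\<delta>: "q\<^sup>2 - 1 = q * \<delta>"
  using q_nonzero by (simp add: \<delta>_def algebra_simps power2_eq_square)

lemma endom_\<Omega>: "endom \<Omega>"
  by (simp add: endom_iff \<Omega>_def endom_apply[OF exp_e.endom_exp_T] endom_apply[OF exp_n.endom_exp_T] \<Psi>_apply)

lemma bij_\<Omega>: "bij \<Omega>"
proof -
  have "\<Omega> = exp_n.exp_T \<circ> \<Psi> \<circ> exp_e.exp_T" by (simp add: \<Omega>_def fun_eq_iff)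
  then have "inj \<Omega>"
    using exp_n.inj_exp_T inj_\<Psi> exp_e.inj_exp_T by (simp add: inj_compose)
  then show ?thesis
    using linear_inj_imp_surj[OF endom_\<Omega>] by (simp add: bij_def)
qed

text \<open>The chain is \<open>exp\<^sub>q(e) y = (k + \<delta> f) exp\<^sub>q(e)\<close>, then \<open>\<Psi> (k + \<delta> f) = (k + \<delta> k f k) \<Psi>\<close>, and finally
  \<open>exp\<^sub>q(n\<^sub>z) (k + \<delta> k f k) = k exp\<^sub>q(n\<^sub>z)\<close>, as \<open>k + \<delta> k f k = k (1 - (q\<^sup>2 - 1) n\<^sub>z)\<close>.\<close>
lemma k_\<Omega>: "k (\<Omega> v) = \<Omega> (y v)"
proof -
  let ?w = "exp_e.exp_T v"
  have "exp_e.exp_T (\<delta> *s f v) = \<delta> *s f ?w + k ?w - exp_e.exp_T (k' v)"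
  proof (rule exp_e.exp_commutator)
    show "endom (\<lambda>v. \<delta> *s f v)" by (rule exp_f.endom_scaled)
    show "e (\<delta> *s f v) - \<delta> *s f (e v) = k v - k' v" for v
      using e_f'[of v] by (simp add: e_apply)
  qed
  then have "exp_e.exp_T (y v) = k ?w + \<delta> *s f ?w"
    by (simp add: y_def endom_apply[OF exp_e.endom_exp_T])
  then have "\<Omega> (y v) = exp_n.exp_T (k (\<Psi> ?w) + \<delta> *s k (f (k (\<Psi> ?w))))"
    by (simp add: \<Omega>_def \<Psi>_apply \<Psi>_k \<Psi>_f)
  also have "k u + \<delta> *s k (f (k u)) = k (u - (q\<^sup>2 - 1) *s n_z u)" for u
  proof -
    have "f (k u) = q\<^sup>2 *s k (f u)" using q_nonzero by (simp add: k_f)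
    then show ?thesis
      unfolding n_z_def q\<delta> by (simp add: k_apply power2_eq_square mult_ac)
  qed
  finally show ?thesis by (simp add: exp_n.exp_A' \<Omega>_def)
qed

text \<open>Since \<open>z = k\<inverse> (1 - (q\<^sup>2 - 1) e)\<close> and \<open>y = (1 - (q\<^sup>2 - 1) n\<^sub>z) k\<inverse>\<close>, the first exponential turns \<open>z\<close> into
  \<open>k\<inverse>\<close>, which commutes with \<open>\<Psi>\<close>, and the second turns \<open>k\<inverse>\<close> into \<open>y\<close>.\<close>
lemma y_\<Omega>: "y (\<Omega> v) = \<Omega> (z v)"
proof -
  have "z v = k' (v - (q\<^sup>2 - 1) *s e v)" by (simp add: z_def q\<delta> k'_apply)
  then have "\<Omega> (z v) = exp_n.exp_T (k' (\<Psi> (exp_e.exp_T v)))"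
    by (simp add: \<Omega>_def exp_e.exp_A' \<Psi>_k')
  also have "\<dots> = k' (\<Omega> v) - (q\<^sup>2 - 1) *s n_z (k' (\<Omega> v))"
    unfolding \<Omega>_def by (rule exp_n.exp_A)
  also have "\<dots> = y (\<Omega> v)"
    unfolding q\<delta> using q_nonzero by (simp add: y_def n_z_def k_f k_k' power2_eq_square) (simp add: field_simps)
  finally show ?thesis ..
qed

text \<open>Moving \<open>k\<close> through \<open>exp\<^sub>q(e)\<close> and \<open>\<Psi>\<close> gives \<open>k + g\<close> with \<open>g = - q \<delta> k\<inverse> e\<close>. As
  \<open>n\<^sub>z g - g n\<^sub>z = k\<inverse> - k\<close>, the rule \<open>exp_commutator\<close> yields
  \<open>exp\<^sub>q(n\<^sub>z) (k + g) = (g + k\<inverse>) exp\<^sub>q(n\<^sub>z)\<close>, and \<open>g + k\<inverse> = z\<close>.\<close>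
lemma z_\<Omega>: "z (\<Omega> v) = \<Omega> (k v)"
proof -
  let ?u = "\<Psi> (exp_e.exp_T v)"
  have "\<Psi> (exp_e.exp_T (k v)) = k ?u - (q * \<delta>) *s k' (e ?u)"
    by (simp add: exp_e.exp_A q\<delta> \<Psi>_apply \<Psi>_k \<Psi>_e k'_k)
  then have "\<Omega> (k v) = exp_n.exp_T (k ?u) + exp_n.exp_T (- (q * \<delta>) *s k' (e ?u))"
    by (simp add: \<Omega>_def endom_apply[OF exp_n.endom_exp_T])
  also have "exp_n.exp_T (- (q * \<delta>) *s k' (e ?u)) =
      - (q * \<delta>) *s k' (e (exp_n.exp_T ?u)) + k' (exp_n.exp_T ?u) - exp_n.exp_T (k ?u)"
  proof (rule exp_n.exp_commutator)
    show "endom (\<lambda>v. - (q * \<delta>) *s k' (e v))"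
      by (simp add: endom_iff k'_apply e_apply scale_right_distrib mult_ac)
    fix v
    have n: "n_z (k' (e v)) = - inverse q *s f (e v)" "k' (e (n_z v)) = - inverse q *s e (f v)"
      using q_nonzero
      by (simp_all add: n_z_def k_apply k_k' e_apply f_apply k'_apply exp_e.comm' k_f k'_f k'_k k_e power2_eq_square)
         (simp_all add: field_simps)
    have "n_z (- (q * \<delta>) *s k' (e v)) - - (q * \<delta>) *s k' (e (n_z v)) = \<delta> *s f (e v) - \<delta> *s e (f v)"
    proof -
      have "- (q * \<delta>) * - inverse q = \<delta>" using q_nonzero by simp
      then show ?thesis by (simp only: endom_apply[OF endom_n_z] n scale_scale)
    qed
    then show "n_z (- (q * \<delta>) *s k' (e v)) - - (q * \<delta>) *s k' (e (n_z v)) = k' v - k v"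
      by (simp add: e_f')
  qed
  finally show ?thesis by (simp add: \<Omega>_def z_def)
qed

end

section \<open>From modules over \<open>Uq q\<close> to operators\<close>

abbreviation free_ring :: "'k::field uq_free ring" where
  "free_ring \<equiv> ring_of_type_algebra"

lemma free_ring_simps:
  "carrier free_ring = UNIV" "x \<otimes>\<^bsub>free_ring\<^esub> y = x * y" "x \<oplus>\<^bsub>free_ring\<^esub> y = x + y"
  "\<one>\<^bsub>free_ring\<^esub> = 1" "\<zero>\<^bsub>free_ring\<^esub> = 0"
  by (simp_all add: ring_of_type_algebra_def)

lemma ring_free_ring: "ring (free_ring :: 'k::field uq_free ring)"
proof (intro ringI abelian_groupI monoidI)
  fix x :: "'k uq_free"
  show "\<exists>y\<in>carrier free_ring. y \<oplus>\<^bsub>free_ring\<^esub> x = \<zero>\<^bsub>free_ring\<^esub>"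
    by (rule bexI[of _ "- x"]) (simp_all add: free_ring_simps)
qed (simp_all add: free_ring_simps algebra_simps)

lemma ideal_uq_ideal: "ideal (uq_ideal q) free_ring"
  unfolding uq_ideal_def
  by (rule ring.genideal_ideal[OF ring_free_ring]) (simp add: free_ring_simps)

text \<open>The quotient map, so that identities between formulas in the generators can be verified in the free
  algebra, where products and sums are those of the type class.\<close>
lemma hom_uq_class: "ring_hom_ring free_ring (Uq q) (uq_class q)"
proof -
  have "uq_class q = (+>\<^bsub>free_ring\<^esub>) (uq_ideal q)"
    by (rule ext) (simp add: uq_class_def)
  then show ?thesis
    unfolding Uq_def using ideal.rcos_ring_hom_ring[OF ideal_uq_ideal] by simp
qed

lemma uq_class_carrier: "uq_class q a \<in> carrier (Uq q)"
  and uq_class_mult: "uq_class q a \<otimes>\<^bsub>Uq q\<^esub> uq_class q b = uq_class q (a * b)"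
  and uq_class_add: "uq_class q a \<oplus>\<^bsub>Uq q\<^esub> uq_class q b = uq_class q (a + b)"
  and uq_class_one: "\<one>\<^bsub>Uq q\<^esub> = uq_class q 1"
  and uq_class_zero: "\<zero>\<^bsub>Uq q\<^esub> = uq_class q 0"
proof -
  interpret ring_hom_ring free_ring "Uq q" "uq_class q" by (rule hom_uq_class)
  show "uq_class q a \<in> carrier (Uq q)"
    using hom_closed[of a] by (simp add: free_ring_simps)
  show "uq_class q a \<otimes>\<^bsub>Uq q\<^esub> uq_class q b = uq_class q (a * b)"
    using hom_mult[of a b] by (simp add: free_ring_simps)
  show "uq_class q a \<oplus>\<^bsub>Uq q\<^esub> uq_class q b = uq_class q (a + b)"
    using hom_add[of a b] by (simp add: free_ring_simps)
  show "\<one>\<^bsub>Uq q\<^esub> = uq_class q 1"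
    using hom_one by (simp add: free_ring_simps)
  show "\<zero>\<^bsub>Uq q\<^esub> = uq_class q 0"
    using hom_zero by (simp add: free_ring_simps)
qed

lemma uq_class_minus: "uq_class q a \<ominus>\<^bsub>Uq q\<^esub> uq_class q b = uq_class q (a - b)"
proof -
  interpret ring_hom_ring free_ring "Uq q" "uq_class q" by (rule hom_uq_class)
  have "(uq_class q a \<ominus>\<^bsub>Uq q\<^esub> uq_class q b) = uq_class q (a - b) \<oplus>\<^bsub>Uq q\<^esub> uq_class q b \<ominus>\<^bsub>Uq q\<^esub> uq_class q b"
    by (simp add: uq_class_add)
  also have "\<dots> = uq_class q (a - b)"
    by (simp add: S.minus_eq S.a_assoc S.r_neg uq_class_carrier)
  finally show ?thesis .
qed

lemma uq_class_relation:
  assumes "r \<in> uq_relations q"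
  shows "uq_class q r = uq_class q 0"
proof -
  have "r \<in> uq_ideal q"
    unfolding uq_ideal_def
    using ring.genideal_self[OF ring_free_ring, of "uq_relations q"] assms
    by (auto simp: free_ring_simps)
  then have "uq_class q r = uq_ideal q"
    unfolding uq_class_def
  proof -
    interpret ideal "uq_ideal q" free_ring by (rule ideal_uq_ideal)
    show "uq_ideal q +>\<^bsub>free_ring\<^esub> r = uq_ideal q" by (rule a_rcos_const) fact
  qed
  moreover have "\<zero>\<^bsub>Uq q\<^esub> = uq_ideal q" by (simp add: Uq_def FactRing_def)
  ultimately show ?thesis by (simp add: uq_class_zero)
qed

context uq_module
begin

text \<open>Pulling the action back to the free algebra turns every element of \<open>Uq q\<close> that is given by a formula in the
  generators into an operator that can be computed by rewriting.\<close>
definition act_free :: "'k uq_free \<Rightarrow> 'v \<Rightarrow> 'v" where "act_free a = act (uq_class q a)"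

lemma linear_act_free: "Vector_Spaces.linear scale scale (act_free a)"
  unfolding act_free_def by (rule act_linear) (rule uq_class_carrier)

lemma act_free_1: "act_free 1 v = v"
  using act_one by (simp add: act_free_def uq_class_one)

lemma act_free_mult: "act_free (a * b) v = act_free a (act_free b v)"
  using act_mult[OF uq_class_carrier uq_class_carrier] by (simp add: act_free_def uq_class_mult)

lemma act_free_add: "act_free (a + b) v = act_free a v + act_free b v"
  using act_add[OF uq_class_carrier uq_class_carrier] by (simp add: act_free_def uq_class_add)

lemma act_free_diff: "act_free (a - b) v = act_free a v - act_free b v"
  using act_free_add[of "a - b" b v] by simp

lemma act_free_const: "act_free (free_const c) v = scale c v"
proof -
  have "act_free (free_const c * 1) v = scale c (act_free 1 v)"
    using act_scale[OF uq_class_carrier] by (simp add: act_free_def uq_scale_def uq_class_mult del: mult_1_right)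
  then show ?thesis by (simp add: act_free_1)
qed

lemma act_free_relation: "r \<in> uq_relations q \<Longrightarrow> act_free r v = 0"
  using act_free_add[of 0 0 v] by (simp add: act_free_def uq_class_relation)

end

theorem theorem7p5:
  fixes q :: "'k::field"
    and scale :: "'k \<Rightarrow> 'v::ab_group_add \<Rightarrow> 'v"
    and Basis :: "'v set"
    and act :: "'k uq_free set \<Rightarrow> 'v \<Rightarrow> 'v"
  assumes char: "CHAR('k) \<noteq> 2"
    and q_nonzero: "q \<noteq> 0"
    and q_not_root: "\<And>n::nat. n > 0 \<Longrightarrow> q ^ n \<noteq> 1"
    and fin_dim: "finite_dimensional_vector_space scale Basis"
    and module: "uq_module q scale act"
  defines "\<Omega> \<equiv> uq_Omega q scale act"
  shows "bij \<Omega>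
    \<and> inv_into UNIV \<Omega> \<circ> act (uq_x q) \<circ> \<Omega> = act (uq_y q)
    \<and> inv_into UNIV \<Omega> \<circ> act (uq_y q) \<circ> \<Omega> = act (uq_z q)
    \<and> inv_into UNIV \<Omega> \<circ> act (uq_z q) \<circ> \<Omega> = act (uq_x q)"
proof -
  interpret M: uq_module q scale act by (rule module)
  define k k' e f where "k = M.act_free (free_gen Gen_k)" and "k' = M.act_free (free_gen Gen_kinv)"
    and "e = M.act_free (free_gen Gen_e)" and "f = M.act_free (free_gen Gen_f)"
  note defs = k_def k'_def e_def f_def
  have two: "(2::'k) \<noteq> 0"
  proof
    assume "(2::'k) = 0"
    then have "CHAR('k) dvd 2" using of_nat_eq_0_iff_char_dvd[of 2, where ?'a = 'k] by simp
    then have "CHAR('k) \<le> 2" by (rule dvd_imp_le) simp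
    moreover have "CHAR('k) \<noteq> 0" using \<open>CHAR('k) dvd 2\<close> by (metis dvd_0_left zero_neq_numeral)
    ultimately show False using char CHAR_not_1' by (metis One_nat_def le_neq_implies_less less_2_cases)
  qed
  have rel: "k (k' v) - v = 0" "k' (k v) - v = 0" "k (e v) - scale (q\<^sup>2) (e (k v)) = 0"
    "k (f v) - scale (inverse q ^ 2) (f (k v)) = 0"
    "e (f v) - f (e v) - scale (1 / (q - inverse q)) (k v - k' v) = 0" for v
    unfolding defs M.act_free_mult[symmetric] M.act_free_const[symmetric] M.act_free_diff[symmetric]
    by (subst M.act_free_1[symmetric, of v], unfold M.act_free_diff[symmetric] M.act_free_mult[symmetric] mult.assoc[symmetric],
        rule M.act_free_relation, simp add: uq_relations_def Let_def)+
  interpret R: uq_rep scale Basis q k k' e f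
  proof (intro uq_rep.intro q_space.intro fd_space.intro q_space_axioms.intro uq_rep_axioms.intro)
    show "Vector_Spaces.linear scale scale k" "Vector_Spaces.linear scale scale k'"
      "Vector_Spaces.linear scale scale e" "Vector_Spaces.linear scale scale f"
      unfolding defs by (rule M.linear_act_free)+
    fix v
    show "k (k' v) = v" "k' (k v) = v" "k (e v) = scale (q\<^sup>2) (e (k v))"
      "k (f v) = scale (inverse (q\<^sup>2)) (f (k v))"
      "e (f v) - f (e v) = scale (1 / (q - inverse q)) (k v - k' v)"
      using rel[of v] by (simp_all add: power_inverse)
  qed (fact q_nonzero q_not_root two fin_dim)+
  have x: "act (uq_x q) = k"
    by (simp add: k_def M.act_free_def uq_x_def uq_k_def)
  have "uq_y q = uq_class q (free_gen Gen_kinv + free_const (q - inverse q) * free_gen Gen_f)"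
    by (simp add: uq_y_def uq_scale_def uq_kinv_def uq_f_def uq_class_add uq_class_mult)
  then have y: "act (uq_y q) = R.y"
    by (simp add: fun_eq_iff M.act_free_def[symmetric] M.act_free_add M.act_free_mult M.act_free_const R.y_def R.\<delta>_def defs[symmetric])
  have "uq_z q = uq_class q (free_gen Gen_kinv - free_const (q * (q - inverse q)) * (free_gen Gen_kinv * free_gen Gen_e))"
    by (simp add: uq_z_def uq_scale_def uq_kinv_def uq_e_def uq_class_minus uq_class_mult)
  then have z: "act (uq_z q) = R.z"
    by (simp add: fun_eq_iff M.act_free_def[symmetric] M.act_free_diff M.act_free_mult M.act_free_const R.z_def R.\<delta>_def defs[symmetric])
  have act_scaled_diff: "act (uq_scale q c (\<one>\<^bsub>Uq q\<^esub> \<ominus>\<^bsub>Uq q\<^esub> (a \<otimes>\<^bsub>Uq q\<^esub> b))) v = scale c (v - act a (act b v))"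
    if "a \<in> range (uq_class q)" "b \<in> range (uq_class q)" for a b c v
    using that
    by (auto simp: uq_scale_def uq_class_one uq_class_mult uq_class_minus M.act_free_def[symmetric]
        M.act_free_mult M.act_free_diff M.act_free_const M.act_free_1)
  have xyz: "uq_x q \<in> range (uq_class q)" "uq_y q \<in> range (uq_class q)" "uq_z q \<in> range (uq_class q)"
    using \<open>uq_y q = _\<close> \<open>uq_z q = _\<close> by (auto simp: uq_x_def uq_k_def)
  have ny: "act (uq_ny q) = e"
  proof
    fix v
    have "act (uq_ny q) v = scale (q / R.\<delta>) (v - R.z (k v))"
      by (simp add: uq_ny_def act_scaled_diff xyz x z R.\<delta>_def)
    also have "R.z (k v) = v - scale (q * R.\<delta> * inverse (q\<^sup>2)) (e v)"
      by (simp add: R.z_def R.k'_k R.exp_e.comm')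
    also have "scale (q / R.\<delta>) (v - (v - scale (q * R.\<delta> * inverse (q\<^sup>2)) (e v))) =
        scale (q / R.\<delta> * (q * R.\<delta> * inverse (q\<^sup>2))) (e v)"
      by simp
    also have "q / R.\<delta> * (q * R.\<delta> * inverse (q\<^sup>2)) = 1"
      using R.\<delta>_nonzero q_nonzero by (simp add: field_simps power2_eq_square)
    also have "scale 1 (e v) = e v" by simp
    finally show "act (uq_ny q) v = e v" .
  qed
  have nz: "act (uq_nz q) = R.n_z"
  proof
    fix v
    have "act (uq_nz q) v = scale (q / R.\<delta>) (v - k (R.y v))"
      by (simp add: uq_nz_def act_scaled_diff xyz x y R.\<delta>_def)
    also have "\<dots> = R.n_z v"
      using R.\<delta>_nonzero by (simp add: R.y_def R.n_z_def R.k_apply R.k_k')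
    finally show "act (uq_nz q) v = R.n_z v" .
  qed
  have "uq_Psi q scale act = R.\<Psi>"
    unfolding uq_Psi_def R.\<Psi>_def R.weight_operator_def weight_space_def x by simp
  then have \<Omega>: "\<Omega> = R.\<Omega>"
    unfolding \<Omega>_def uq_Omega_def ny nz R.\<Omega>_def[abs_def] R.exp_n.exp_T_def R.exp_e.exp_T_def by auto
  have conj: "inv_into UNIV R.\<Omega> \<circ> a \<circ> R.\<Omega> = b" if "\<And>v. a (R.\<Omega> v) = R.\<Omega> (b v)" for a b
    using that R.bij_\<Omega> by (auto simp: fun_eq_iff bij_is_inj inv_f_f)
  show ?thesis
    unfolding \<Omega> x y z
    using R.bij_\<Omega> conj[of k R.y] conj[of R.y R.z] conj[of R.z k] R.k_\<Omega> R.y_\<Omega> R.z_\<Omega> by blast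
qed

end
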